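(* Let $(N,\omega,g,J)$ be a gradient shrinking Kähler-Ricci soliton of real dimension $2m$ with potential function $f\colon N\to\mathbb{R}$, i.e. $\mathrm{Ric}(g)+\mathrm{Hess}_{g}f=g$, and assume that the scalar curvature satisfies $R(g)<2m$ on $N$. Then there exists no compact Lagrangian self-expander in $N$; that is, there is no Lagrangian immersion $F\colon L\to N$ of a compact manifold $L$ satisfying $H=\lambda{\nabla f}^{\bot}$ for some constant $\lambda>0$.
   Context: A gradient shrinking Kähler-Ricci soliton is a Kähler manifold $(N,\omega,g,J)$ (Kähler form $\omega(\cdot,\cdot)=g(J\cdot,\cdot)$, Riemannian metric $g$, complex structure $J$) together with a smooth function $f\colon N\to\mathbb{R}$ (the potential function) satisfying $\mathrm{Ric}(g)+\mathrm{Hess}_{g}f=g$. $R(g)$ is the scalar curvature of $(N,g)$ and $\nabla f$ is the gradient of $f$ with respect to $g$. For an immersion $F\colon L\to N$, $\nabla f$ along $F$ means the section $(\nabla f)\circ F$ of $F^{*}(TN)$; $\bot$ denotes the orthogonal projection onto the normal bundle of $L$; $H$ is the mean curvature vector field of $F$, i.e. the trace of the second fundamental form with respect to $F^{*}g$ (not divided by the dimension). An immersion $F\colon L\to N$ is a self-similar solution if $H=\lambda{\nabla f}^{\bot}$ for some constant $\lambda\in\mathbb{R}$, and is called a self-expander if $\lambda>0$. $F$ is Lagrangian if $\dim L=m$ and $F^{*}\omega=0$. "Compact" means that the (nonempty) manifold $L$ is compact, without boundary. *)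

theory Defs
  imports "HOL-Analysis.Analysis"
begin

section \<open>Smooth maps between open subsets of Euclidean spaces\<close>

abbreviation deriv_at :: "('e::real_normed_vector \<Rightarrow> 'v::real_normed_vector) \<Rightarrow> 'e \<Rightarrow> 'e \<Rightarrow> 'v" where
  "deriv_at f x \<equiv> frechet_derivative f (at x)"

definition deriv2_at :: "('e::real_normed_vector \<Rightarrow> 'v::real_normed_vector) \<Rightarrow> 'e \<Rightarrow> 'e \<Rightarrow> 'e \<Rightarrow> 'v" where
  "deriv2_at f x u v = deriv_at (\<lambda>y. deriv_at f y v) x u"

text \<open>On finite-dimensional spaces, a map is C^(k+1) on an open set iff it is differentiable and
  all its directional derivatives are C^k. The set is always open where this is used.\<close>

primrec ck_on :: "nat \<Rightarrow> 'e::real_normed_vector set \<Rightarrow> ('e \<Rightarrow> 'v::real_normed_vector) \<Rightarrow> bool" where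
  "ck_on 0 S f \<longleftrightarrow> continuous_on S f"
| "ck_on (Suc k) S f \<longleftrightarrow>
     (\<forall>x\<in>S. f differentiable (at x)) \<and> (\<forall>v. ck_on k S (\<lambda>x. deriv_at f x v))"

definition smooth_on :: "'e::real_normed_vector set \<Rightarrow> ('e \<Rightarrow> 'v::real_normed_vector) \<Rightarrow> bool" where
  "smooth_on S f \<longleftrightarrow> (\<forall>k. ck_on k S f)"

section \<open>Manifolds\<close>

text \<open>A chart is a pair of its domain and its coordinate map; the values of the coordinate map
  outside the domain are irrelevant.\<close>

type_synonym ('a, 'e) chart = "'a set \<times> ('a \<Rightarrow> 'e)"

record ('a, 'e) manifold =
  mtop :: "'a topology"
  atlas :: "('a, 'e) chart set"

definition coords :: "('a, 'e) chart \<Rightarrow> 'e set" where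
  "coords c = snd c ` fst c"

definition param :: "('a, 'e) chart \<Rightarrow> 'e \<Rightarrow> 'a" where
  "param c = inv_into (fst c) (snd c)"

text \<open>The expression of a map in charts of its source and target, and the part of the source
  coordinates on which it makes sense. Transition maps are the case of the identity map.\<close>

definition in_charts :: "('b, 'd) chart \<Rightarrow> ('b \<Rightarrow> 'a) \<Rightarrow> ('a, 'e) chart \<Rightarrow> 'd \<Rightarrow> 'e" where
  "in_charts c F d = snd d \<circ> F \<circ> param c"

definition chart_overlap :: "('b, 'd) chart \<Rightarrow> ('b \<Rightarrow> 'a) \<Rightarrow> ('a, 'e) chart \<Rightarrow> 'd set" where
  "chart_overlap c F d = snd c ` {p \<in> fst c. F p \<in> fst d}"

definition is_chart :: "'a topology \<Rightarrow> ('a, 'e::euclidean_space) chart \<Rightarrow> bool" where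
  "is_chart X c \<longleftrightarrow> openin X (fst c) \<and> open (coords c) \<and>
     homeomorphic_map (subtopology X (fst c)) (top_of_set (coords c)) (snd c)"

definition smooth_manifold :: "('a, 'e::euclidean_space) manifold \<Rightarrow> bool" where
  "smooth_manifold N \<longleftrightarrow>
     Hausdorff_space (mtop N) \<and> second_countable (mtop N) \<and>
     (\<forall>c\<in>atlas N. is_chart (mtop N) c) \<and>
     (\<Union>c\<in>atlas N. fst c) = topspace (mtop N) \<and>
     (\<forall>c\<in>atlas N. \<forall>d\<in>atlas N. smooth_on (chart_overlap c id d) (in_charts c id d))"

definition smooth_fun :: "('a, 'e::euclidean_space) manifold \<Rightarrow> ('a \<Rightarrow> real) \<Rightarrow> bool" where
  "smooth_fun N f \<longleftrightarrow> (\<forall>c\<in>atlas N. smooth_on (coords c) (f \<circ> param c))"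

definition smooth_map ::
  "('b, 'd::euclidean_space) manifold \<Rightarrow> ('a, 'e::euclidean_space) manifold \<Rightarrow> ('b \<Rightarrow> 'a) \<Rightarrow> bool" where
  "smooth_map L N F \<longleftrightarrow> continuous_map (mtop L) (mtop N) F \<and>
     (\<forall>c\<in>atlas L. \<forall>d\<in>atlas N. smooth_on (chart_overlap c F d) (in_charts c F d))"

definition immersion ::
  "('b, 'd::euclidean_space) manifold \<Rightarrow> ('a, 'e::euclidean_space) manifold \<Rightarrow> ('b \<Rightarrow> 'a) \<Rightarrow> bool" where
  "immersion L N F \<longleftrightarrow> smooth_map L N F \<and>
     (\<forall>c\<in>atlas L. \<forall>d\<in>atlas N. \<forall>x\<in>chart_overlap c F d. inj (deriv_at (in_charts c F d) x))"

section \<open>Riemannian geometry in a coordinate domain\<close>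

text \<open>A metric on a coordinate domain in \<open>'e\<close> assigns to each point a bilinear form on \<open>'e\<close>,
  the tangent space at that point; vectors of \<open>'e\<close> double as coordinate vector fields, i.e. vector
  fields with constant components.\<close>

type_synonym 'e bform = "'e \<Rightarrow> 'e \<Rightarrow> real"

definition inner_product :: "'e::euclidean_space bform \<Rightarrow> bool" where
  "inner_product B \<longleftrightarrow> bilinear B \<and> (\<forall>u v. B u v = B v u) \<and> (\<forall>v. v \<noteq> 0 \<longrightarrow> B v v > 0)"

definition sharp :: "'e::euclidean_space bform \<Rightarrow> ('e \<Rightarrow> real) \<Rightarrow> 'e" where
  "sharp B \<alpha> = (THE v. \<forall>w. B v w = \<alpha> w)"

text \<open>In components, \<open>metric_trace g T\<close> is $g^{ij} T_{ij}$: the vector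
  \<open>sharp g (\<lambda>w. w \<bullet> i)\<close> has components $g^{ij}$. The form \<open>T\<close> may be vector valued.\<close>

definition metric_trace :: "'e::euclidean_space bform \<Rightarrow> ('e \<Rightarrow> 'e \<Rightarrow> 'v::real_vector) \<Rightarrow> 'v" where
  "metric_trace B T = (\<Sum>i\<in>Basis. T (sharp B (\<lambda>w. w \<bullet> i)) i)"

definition gradient :: "('e::euclidean_space \<Rightarrow> 'e bform) \<Rightarrow> ('e \<Rightarrow> real) \<Rightarrow> 'e \<Rightarrow> 'e" where
  "gradient g f x = sharp (g x) (deriv_at f x)"

text \<open>\<open>christoffel g x u v\<close> is the Levi-Civita derivative of the coordinate field \<open>v\<close> in the
  direction \<open>u\<close>, given by the Koszul formula.\<close>

definition christoffel :: "('e::euclidean_space \<Rightarrow> 'e bform) \<Rightarrow> 'e \<Rightarrow> 'e \<Rightarrow> 'e \<Rightarrow> 'e" where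
  "christoffel g x u v = sharp (g x) (\<lambda>w.
     (deriv_at (\<lambda>y. g y v w) x u + deriv_at (\<lambda>y. g y u w) x v - deriv_at (\<lambda>y. g y u v) x w) / 2)"

definition hessian :: "('e::euclidean_space \<Rightarrow> 'e bform) \<Rightarrow> ('e \<Rightarrow> real) \<Rightarrow> 'e \<Rightarrow> 'e bform" where
  "hessian g f x u v = deriv2_at f x u v - deriv_at f x (christoffel g x u v)"

text \<open>$R(u,v)w = \nabla_u \nabla_v w - \nabla_v \nabla_u w$ for coordinate fields, and
  $\mathrm{Ric}(v,w) = \mathrm{tr}(u \mapsto R(u,v)w)$, so that round spheres have positive Ricci
  curvature.\<close>

definition curvature :: "('e::euclidean_space \<Rightarrow> 'e bform) \<Rightarrow> 'e \<Rightarrow> 'e \<Rightarrow> 'e \<Rightarrow> 'e \<Rightarrow> 'e" where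
  "curvature g x u v w =
     deriv_at (\<lambda>y. christoffel g y v w) x u - deriv_at (\<lambda>y. christoffel g y u w) x v
     + christoffel g x u (christoffel g x v w) - christoffel g x v (christoffel g x u w)"

definition ricci :: "('e::euclidean_space \<Rightarrow> 'e bform) \<Rightarrow> 'e \<Rightarrow> 'e bform" where
  "ricci g x v w = (\<Sum>i\<in>Basis. curvature g x i v w \<bullet> i)"

definition scalar_curvature :: "('e::euclidean_space \<Rightarrow> 'e bform) \<Rightarrow> 'e \<Rightarrow> real" where
  "scalar_curvature g x = metric_trace (g x) (ricci g x)"

subsection \<open>Immersed submanifolds\<close>

definition normal_part :: "'e::euclidean_space bform \<Rightarrow> 'e set \<Rightarrow> 'e \<Rightarrow> 'e" where
  "normal_part B W v = (THE n. v - n \<in> W \<and> (\<forall>w\<in>W. B n w = 0))"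

definition pullback_metric ::
  "('e \<Rightarrow> 'e bform) \<Rightarrow> ('d::euclidean_space \<Rightarrow> 'e::euclidean_space) \<Rightarrow> 'd \<Rightarrow> 'd bform" where
  "pullback_metric g F x u v = g (F x) (deriv_at F x u) (deriv_at F x v)"

text \<open>The first two summands are the covariant derivative, in the direction \<open>u\<close>, of the section
  $dF(v)$ of the pulled-back tangent bundle, for a coordinate field \<open>v\<close>.\<close>

definition second_ff ::
  "('e \<Rightarrow> 'e bform) \<Rightarrow> ('d::euclidean_space \<Rightarrow> 'e::euclidean_space) \<Rightarrow> 'd \<Rightarrow> 'd \<Rightarrow> 'd \<Rightarrow> 'e" where
  "second_ff g F x u v = normal_part (g (F x)) (range (deriv_at F x))
     (deriv2_at F x u v + christoffel g (F x) (deriv_at F x u) (deriv_at F x v))"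

definition mean_curvature ::
  "('e \<Rightarrow> 'e bform) \<Rightarrow> ('d::euclidean_space \<Rightarrow> 'e::euclidean_space) \<Rightarrow> 'd \<Rightarrow> 'e" where
  "mean_curvature g F x = metric_trace (pullback_metric g F x) (second_ff g F x)"

section \<open>Riemannian metrics and self-similar solutions on manifolds\<close>

text \<open>A metric on a manifold is a tensor field in the classical sense: one metric on the coordinate
  domain of each chart, obeying the tensor transformation law. Gradient,
  Hessian, Ricci and scalar curvature and mean curvature transform accordingly, and equations
  between them are required in every chart.\<close>

type_synonym ('a, 'e) metric = "('a, 'e) chart \<Rightarrow> 'e \<Rightarrow> 'e bform"

definition riemannian_metric ::
  "('a, 'e::euclidean_space) manifold \<Rightarrow> ('a, 'e) metric \<Rightarrow> bool" where
  "riemannian_metric N g \<longleftrightarrow>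
     (\<forall>c\<in>atlas N. (\<forall>x\<in>coords c. inner_product (g c x)) \<and>
        (\<forall>u v. smooth_on (coords c) (\<lambda>x. g c x u v))) \<and>
     (\<forall>c\<in>atlas N. \<forall>d\<in>atlas N. \<forall>x\<in>chart_overlap c id d.
        g c x = pullback_metric (g d) (in_charts c id d) x)"

definition self_similar ::
  "('b, 'd::euclidean_space) manifold \<Rightarrow> ('a, 'e::euclidean_space) manifold \<Rightarrow> ('a, 'e) metric \<Rightarrow>
   ('a \<Rightarrow> real) \<Rightarrow> ('b \<Rightarrow> 'a) \<Rightarrow> real \<Rightarrow> bool" where
  "self_similar L N g f F \<mu> \<longleftrightarrow> immersion L N F \<and>
     (\<forall>c\<in>atlas L. \<forall>d\<in>atlas N. \<forall>x\<in>chart_overlap c F d.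
        let F' = in_charts c F d in
        mean_curvature (g d) F' x =
          \<mu> *\<^sub>R normal_part (g d (F' x)) (range (deriv_at F' x))
                 (gradient (g d) (f \<circ> param d) (F' x)))"

definition self_expander ::
  "('b, 'd::euclidean_space) manifold \<Rightarrow> ('a, 'e::euclidean_space) manifold \<Rightarrow> ('a, 'e) metric \<Rightarrow>
   ('a \<Rightarrow> real) \<Rightarrow> ('b \<Rightarrow> 'a) \<Rightarrow> bool" where
  "self_expander L N g f F \<longleftrightarrow> (\<exists>\<mu>>0. self_similar L N g f F \<mu>)"

section \<open>Kaehler manifolds and solitons\<close>

text \<open>A complex manifold of complex dimension \<open>CARD('m)\<close> is given by an atlas of charts to
  \<open>complex^'m\<close>, a real Euclidean space of dimension \<open>2 * CARD('m)\<close>, whose transition maps are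
  holomorphic, i.e. have complex linear differentials. Its complex structure is multiplication
  by \<open>\<i>\<close> in each chart. Derivatives and traces above are always the real ones.\<close>

definition cplx_J :: "complex^'m \<Rightarrow> complex^'m" where
  "cplx_J v = \<i> *s v"

definition complex_manifold :: "('a, complex^'m) manifold \<Rightarrow> bool" where
  "complex_manifold N \<longleftrightarrow> smooth_manifold N \<and>
     (\<forall>c\<in>atlas N. \<forall>d\<in>atlas N. \<forall>x\<in>chart_overlap c id d. \<forall>v.
        deriv_at (in_charts c id d) x (cplx_J v) = cplx_J (deriv_at (in_charts c id d) x v))"

definition kaehler_form :: "('a, complex^'m) metric \<Rightarrow> ('a, complex^'m) metric" where
  "kaehler_form g c x u v = g c x (cplx_J u) v"

text \<open>The last clause says $d\omega = 0$, evaluated on coordinate fields.\<close>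

definition kaehler_manifold :: "('a, complex^'m) manifold \<Rightarrow> ('a, complex^'m) metric \<Rightarrow> bool" where
  "kaehler_manifold N g \<longleftrightarrow> complex_manifold N \<and> riemannian_metric N g \<and>
     (\<forall>c\<in>atlas N. \<forall>x\<in>coords c.
        (\<forall>u v. g c x (cplx_J u) (cplx_J v) = g c x u v) \<and>
        (\<forall>u v w. deriv_at (\<lambda>y. kaehler_form g c y v w) x u +
                 deriv_at (\<lambda>y. kaehler_form g c y w u) x v +
                 deriv_at (\<lambda>y. kaehler_form g c y u v) x w = 0))"

definition gradient_shrinking_KR_soliton ::
  "('a, complex^'m) manifold \<Rightarrow> ('a, complex^'m) metric \<Rightarrow> ('a \<Rightarrow> real) \<Rightarrow> bool" where
  "gradient_shrinking_KR_soliton N g f \<longleftrightarrow> kaehler_manifold N g \<and> smooth_fun N f \<and>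
     (\<forall>c\<in>atlas N. \<forall>x\<in>coords c. \<forall>u v.
        ricci (g c) x u v + hessian (g c) (f \<circ> param c) x u v = g c x u v)"

definition lagrangian_immersion ::
  "('b, 'd::euclidean_space) manifold \<Rightarrow> ('a, complex^'m) manifold \<Rightarrow> ('a, complex^'m) metric \<Rightarrow>
   ('b \<Rightarrow> 'a) \<Rightarrow> bool" where
  "lagrangian_immersion L N g F \<longleftrightarrow> immersion L N F \<and> DIM('d) = CARD('m) \<and>
     (\<forall>c\<in>atlas L. \<forall>d\<in>atlas N. \<forall>x\<in>chart_overlap c F d. \<forall>u v.
        let F' = in_charts c F d in
        kaehler_form g d (F' x) (deriv_at F' x u) (deriv_at F' x v) = 0)"

end

theory Submission
  imports Defs
begin

text \<open>
  Suppose that \<open>F\<close> is a compact Lagrangian self-expander, with \<open>H = \<mu> (\<nabla>f)\<^sup>\<bottom>\<close> and \<open>\<mu> > 0\<close>. The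
  contradiction comes from the maximum principle for \<open>f \<circ> F\<close>. By the chain rule, its Laplacian is
  the trace of \<open>Hess f\<close> over the tangent space of \<open>L\<close> plus
  \<open>df(H) = \<mu> |(\<nabla>f)\<^sup>\<bottom>|\<^sup>2 \<ge> 0\<close>. The trace is strictly positive: the soliton equation turns it
  into \<open>m\<close> minus the trace of \<open>Ric\<close>. If \<open>e\<close> runs over an orthonormal basis of the Lagrangian tangent
  space, then \<open>e\<close> and \<open>Je\<close> together run over an orthonormal basis of the tangent space of \<open>N\<close>,
  and \<open>Ric(e,e) = Ric(Je,Je)\<close> on a Kaehler manifold. So the trace of \<open>Ric\<close> over the tangent space
  of \<open>L\<close> is half of the scalar curvature \<open>R\<close>, and the trace of the Hessian is
  \<open>m - R/2 > 0\<close> (\<open>no_lagrangian_expander_at_max\<close>).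

  The argument is carried out only at a point where \<open>f \<circ> F\<close> attains its maximum, in one chart of \<open>L\<close>
  and one of \<open>N\<close>. There the first derivatives vanish, so that \<open>\<nabla>f\<close> is normal to \<open>L\<close>, and the trace
  of the second derivative in coordinates is the Laplacian (\<open>trace_hessian_nonpos_at_max\<close>).

  The geometric input is the invariance of the Ricci form under \<open>J\<close> (\<open>ricci_J_J\<close>). The Koszul formula
  and \<open>d\<omega> = 0\<close> show that the Christoffel symbols commute with \<open>J\<close> (\<open>christoffel_J\<close>); hence so
  does \<open>R(u,v)\<close>, and the pair symmetry of the curvature gives \<open>R(Ju,Jv) = R(u,v)\<close>. Pair symmetry
  rests on Schwarz' theorem for the metric coefficients (\<open>deriv2_at_commute\<close>) and on the
  differentiability of the Christoffel symbols, which solve a linear system with smooth coefficients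
  (\<open>differentiable_sharp\<close>).
\<close>

section \<open>Derivatives in coordinates\<close>

lemma smooth_on_imp_differentiable:
  "smooth_on S f \<Longrightarrow> x \<in> S \<Longrightarrow> f differentiable (at x)"
  unfolding smooth_on_def by (metis ck_on.simps(2))

lemma smooth_on_deriv_at:
  "smooth_on S f \<Longrightarrow> smooth_on S (\<lambda>x. deriv_at f x v)"
  unfolding smooth_on_def by (metis ck_on.simps(2))

lemma smooth_on_imp_continuous_on: "smooth_on S f \<Longrightarrow> continuous_on S f"
  unfolding smooth_on_def by (metis ck_on.simps(1))

lemma has_derivative_deriv_at:
  "f differentiable (at x) \<Longrightarrow> (f has_derivative deriv_at f x) (at x)"
  by (simp add: frechet_derivative_works)

lemma deriv_at_eqI: "(f has_derivative D) (at x) \<Longrightarrow> deriv_at f x = D"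
  by (metis frechet_derivative_at)

lemma deriv_at_cong:
  assumes "open S" "x \<in> S" "\<And>y. y \<in> S \<Longrightarrow> f y = h y"
  shows "deriv_at f x = deriv_at h x"
proof -
  have "(f has_derivative D) (at x) \<longleftrightarrow> (h has_derivative D) (at x)" for D
    using has_derivative_transform_within_open[of f D x UNIV S h]
          has_derivative_transform_within_open[of h D x UNIV S f] assms by auto
  then show ?thesis unfolding frechet_derivative_def by presburger
qed

lemma smooth_on_deriv2:
  assumes "smooth_on S f" "x \<in> S"
  shows "((\<lambda>y. deriv_at f y v) has_derivative (\<lambda>u. deriv2_at f x u v)) (at x)"
  using has_derivative_deriv_at[OF smooth_on_imp_differentiable[OF smooth_on_deriv_at[OF assms(1)] assms(2)]]
  by (simp add: deriv2_at_def[abs_def])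

lemma has_real_derivative_along_line:
  fixes f :: "'e::real_normed_vector \<Rightarrow> real"
  assumes "f differentiable (at (x + t *\<^sub>R u))"
  shows "((\<lambda>t. f (x + t *\<^sub>R u)) has_real_derivative deriv_at f (x + t *\<^sub>R u) u) (at t)"
proof -
  let ?D = "deriv_at f (x + t *\<^sub>R u)"
  have "((\<lambda>t. x + t *\<^sub>R u) has_derivative (\<lambda>s. s *\<^sub>R u)) (at t)"
    by (auto intro!: derivative_eq_intros)
  then have "((\<lambda>t. f (x + t *\<^sub>R u)) has_derivative (\<lambda>s. ?D (s *\<^sub>R u))) (at t)"
    using has_derivative_deriv_at[OF assms] by (rule has_derivative_compose)
  moreover have "linear ?D"
    using assms by (rule linear_frechet_derivative)
  ultimately show ?thesis
    by (simp add: has_field_derivative_def linear_cmul mult_commute_abs)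
qed

text \<open>Two applications of the mean value theorem, one along each side of the parallelogram.\<close>

lemma second_difference_mean_value:
  fixes f :: "'e::real_normed_vector \<Rightarrow> real"
  assumes f: "smooth_on S f" and s: "s > 0" and t: "t > 0"
    and S: "\<And>a b. 0 \<le> a \<Longrightarrow> a \<le> s \<Longrightarrow> 0 \<le> b \<Longrightarrow> b \<le> t \<Longrightarrow> x + a *\<^sub>R u + b *\<^sub>R v \<in> S"
  obtains a b where "0 < a" "a < s" "0 < b" "b < t"
    "f (x + s *\<^sub>R u + t *\<^sub>R v) - f (x + s *\<^sub>R u) - f (x + t *\<^sub>R v) + f x
      = s * t * deriv2_at f (x + a *\<^sub>R u + b *\<^sub>R v) v u"
proof -
  have swap: "x + b *\<^sub>R v + a *\<^sub>R u = x + a *\<^sub>R u + b *\<^sub>R v" for a b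
    by (simp add: algebra_simps)
  define p where "p a = f (x + t *\<^sub>R v + a *\<^sub>R u) - f (x + a *\<^sub>R u)" for a
  have "DERIV p a :> deriv_at f (x + t *\<^sub>R v + a *\<^sub>R u) u - deriv_at f (x + a *\<^sub>R u) u"
    if "0 \<le> a" "a \<le> s" for a
    unfolding p_def using S[OF that, of t] S[OF that, of 0] t
    by (intro DERIV_diff has_real_derivative_along_line smooth_on_imp_differentiable[OF f])
      (auto simp: swap)
  from MVT2[OF s this] obtain a where a: "0 < a" "a < s"
    "p s - p 0 = s * (deriv_at f (x + t *\<^sub>R v + a *\<^sub>R u) u - deriv_at f (x + a *\<^sub>R u) u)"
    by auto
  have "DERIV (\<lambda>b. deriv_at f (x + a *\<^sub>R u + b *\<^sub>R v) u) b :>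
      deriv2_at f (x + a *\<^sub>R u + b *\<^sub>R v) v u" if "0 \<le> b" "b \<le> t" for b
    unfolding deriv2_at_def using S[OF _ _ that, of a] a
    by (intro has_real_derivative_along_line
        smooth_on_imp_differentiable[OF smooth_on_deriv_at[OF f]]) auto
  from MVT2[OF t this] obtain b where b: "0 < b" "b < t"
    "deriv_at f (x + a *\<^sub>R u + t *\<^sub>R v) u - deriv_at f (x + a *\<^sub>R u) u
      = t * deriv2_at f (x + a *\<^sub>R u + b *\<^sub>R v) v u"
    by auto
  show ?thesis
    using that[OF a(1,2) b(1,2)] a(3) b(3)
    by (simp add: p_def swap algebra_simps)
qed

text \<open>Schwarz' theorem: the second difference over a small parallelogram does not see the order of
  its sides, and both second derivatives are its limit after division by the area.\<close>

lemma deriv2_at_commute: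
  fixes f :: "'e::real_normed_vector \<Rightarrow> real"
  assumes "open S" "x \<in> S" and f: "smooth_on S f"
  shows "deriv2_at f x u v = deriv2_at f x v u"
proof -
  obtain r where r: "r > 0" "ball x r \<subseteq> S"
    using assms(1,2) openE by blast
  \<comment> \<open>sides this short keep the parallelogram inside the ball\<close>
  define d where "d n = r / (1 + norm u + norm v) / real (n + 2)" for n
  have den: "1 + norm u + norm v > 0"
    by (smt (verit) norm_ge_zero)
  have d_pos: "d n > 0" for n
    unfolding d_def using r(1) den by simp
  have d_lim: "d \<longlonglongrightarrow> 0"
    unfolding d_def by (rule LIMSEQ_ignore_initial_segment[OF lim_const_over_n])
  have in_S: "x + a *\<^sub>R u + b *\<^sub>R v \<in> S"
    if "0 \<le> a" "a \<le> d n" "0 \<le> b" "b \<le> d n" for a b n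
  proof -
    have "norm (a *\<^sub>R u + b *\<^sub>R v) \<le> a * norm u + b * norm v"
      using that norm_triangle_ineq[of "a *\<^sub>R u" "b *\<^sub>R v"] by simp
    also have "\<dots> \<le> d n * norm u + d n * norm v"
      using that by (intro add_mono mult_right_mono) auto
    also have "\<dots> < d n * (1 + norm u + norm v)"
      using d_pos[of n] by (simp add: algebra_simps)
    also have "\<dots> = r / real (n + 2)"
      using den by (simp add: d_def)
    also have "\<dots> \<le> r"
      using r(1) by (simp add: field_simps)
    finally have "norm (a *\<^sub>R u + b *\<^sub>R v) < r" .
    then have "x + a *\<^sub>R u + b *\<^sub>R v \<in> ball x r"
      by (simp add: dist_norm norm_minus_commute algebra_simps)
    then show ?thesis using r(2) by auto
  qed
  have "\<exists>a b a' b'. 0 < a \<and> a < d n \<and> 0 < b \<and> b < d n \<and> 0 < a' \<and> a' < d n \<and> 0 < b' \<and> b' < d n \<and>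
      deriv2_at f (x + a *\<^sub>R u + b *\<^sub>R v) v u = deriv2_at f (x + b' *\<^sub>R u + a' *\<^sub>R v) u v" for n
  proof -
    obtain a b where 1: "0 < a" "a < d n" "0 < b" "b < d n"
      "f (x + d n *\<^sub>R u + d n *\<^sub>R v) - f (x + d n *\<^sub>R u) - f (x + d n *\<^sub>R v) + f x
        = d n * d n * deriv2_at f (x + a *\<^sub>R u + b *\<^sub>R v) v u"
      using second_difference_mean_value[OF f d_pos d_pos, of n n x u v] in_S by blast
    have "x + a *\<^sub>R v + b *\<^sub>R u \<in> S" if "0 \<le> a" "a \<le> d n" "0 \<le> b" "b \<le> d n" for a b
      using in_S[of b n a] that by (simp add: algebra_simps)
    then obtain a' b' where 2: "0 < a'" "a' < d n" "0 < b'" "b' < d n"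
      "f (x + d n *\<^sub>R v + d n *\<^sub>R u) - f (x + d n *\<^sub>R v) - f (x + d n *\<^sub>R u) + f x
        = d n * d n * deriv2_at f (x + a' *\<^sub>R v + b' *\<^sub>R u) u v"
      using second_difference_mean_value[OF f d_pos d_pos, of n n x v u] by blast
    have "d n * d n * deriv2_at f (x + a *\<^sub>R u + b *\<^sub>R v) v u
        = d n * d n * deriv2_at f (x + a' *\<^sub>R v + b' *\<^sub>R u) u v"
      using 1(5) 2(5) by (simp add: algebra_simps)
    then have "deriv2_at f (x + a *\<^sub>R u + b *\<^sub>R v) v u = deriv2_at f (x + b' *\<^sub>R u + a' *\<^sub>R v) u v"
      using d_pos[of n] by (simp add: algebra_simps)
    then show ?thesis using 1 2 by blast
  qed
  then obtain a b a' b' where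
    ab: "\<And>n. 0 < a n \<and> a n < d n" "\<And>n. 0 < b n \<and> b n < d n"
       "\<And>n. 0 < a' n \<and> a' n < d n" "\<And>n. 0 < b' n \<and> b' n < d n" and
    eq: "\<And>n. deriv2_at f (x + a n *\<^sub>R u + b n *\<^sub>R v) v u = deriv2_at f (x + b' n *\<^sub>R u + a' n *\<^sub>R v) u v"
    by metis
  have lim0: "c \<longlonglongrightarrow> 0" if "\<And>n. 0 < c n \<and> c n < d n" for c :: "nat \<Rightarrow> real"
    by (rule tendsto_sandwich[OF _ _ tendsto_const d_lim]) (use that in \<open>auto intro!: always_eventually less_imp_le\<close>)
  have lim: "(\<lambda>n. deriv2_at f (x + p n *\<^sub>R u + q n *\<^sub>R v) w z) \<longlonglongrightarrow> deriv2_at f x w z"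
    if "\<And>n. 0 < p n \<and> p n < d n" "\<And>n. 0 < q n \<and> q n < d n" for p q w z
  proof -
    have "continuous_on S (\<lambda>y. deriv2_at f y w z)"
      unfolding deriv2_at_def
      by (intro smooth_on_imp_continuous_on smooth_on_deriv_at f)
    then have "isCont (\<lambda>y. deriv2_at f y w z) x"
      using assms(1,2) continuous_on_eq_continuous_at by blast
    moreover have "(\<lambda>n. x + p n *\<^sub>R u + q n *\<^sub>R v) \<longlonglongrightarrow> x + 0 *\<^sub>R u + 0 *\<^sub>R v"
      by (intro tendsto_intros lim0 that)
    ultimately show ?thesis
      by (intro isCont_tendsto_compose[of x "\<lambda>y. deriv2_at f y w z"]) simp_all
  qed
  show ?thesis
    using LIMSEQ_unique[OF lim[OF ab(4,3)] lim[OF ab(1,2), of v u, unfolded eq]] .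
qed

lemma deriv_at_local_max:
  fixes h :: "'e::real_normed_vector \<Rightarrow> real"
  assumes "open U" "x \<in> U" "h differentiable (at x)" "\<And>y. y \<in> U \<Longrightarrow> h y \<le> h x"
  shows "deriv_at h x u = 0"
proof -
  have "deriv_at h x = (\<lambda>v. 0)"
    using assms(4) differential_zero_maxmin[OF assms(2,1) has_derivative_deriv_at[OF assms(3)]]
    by blast
  then show ?thesis by simp
qed

text \<open>If the second derivative in a direction were positive, the first one would be positive shortly
  after the maximum and the function would increase.\<close>

lemma deriv2_at_local_max:
  fixes h :: "'e::real_normed_vector \<Rightarrow> real"
  assumes U: "open U" "x \<in> U" and diff: "\<And>y. y \<in> U \<Longrightarrow> h differentiable (at y)"
    and diff2: "(\<lambda>y. deriv_at h y u) differentiable (at x)"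
    and max: "\<And>y. y \<in> U \<Longrightarrow> h y \<le> h x"
  shows "deriv2_at h x u u \<le> 0"
proof (rule ccontr)
  assume "\<not> deriv2_at h x u u \<le> 0"
  then have pos: "deriv2_at h x u u > 0" by simp
  have "DERIV (\<lambda>t. deriv_at h (x + t *\<^sub>R u) u) 0 :> deriv2_at h x u u"
    using has_real_derivative_along_line[of "\<lambda>y. deriv_at h y u" x 0 u] diff2
    by (simp add: deriv2_at_def)
  from DERIV_pos_inc_right[OF this pos] obtain d where d: "d > 0"
    "\<And>t. 0 < t \<Longrightarrow> t < d \<Longrightarrow> deriv_at h x u < deriv_at h (x + t *\<^sub>R u) u"
    by auto
  have "isCont (\<lambda>t. x + t *\<^sub>R u) (0::real)"
    by (intro continuous_intros)
  then have "eventually (\<lambda>t. x + t *\<^sub>R u \<in> U) (at (0::real))"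
    using U by (simp add: continuous_at_open eventually_at_topological)
      (metis (no_types, lifting) add.right_neutral scale_zero_left)
  then obtain e where e: "e > 0" "\<And>t. 0 < \<bar>t\<bar> \<Longrightarrow> \<bar>t\<bar> < e \<Longrightarrow> x + t *\<^sub>R u \<in> U"
    by (auto simp: eventually_at dist_real_def)
  define s where "s = min d e / 2"
  have s: "0 < s" "s < d" "s < e" using d e by (auto simp: s_def)
  have in_U: "x + t *\<^sub>R u \<in> U" if "0 \<le> t" "t \<le> s" for t
    using e(2)[of t] that s U(2) by (cases "t = 0") auto
  have "DERIV (\<lambda>t. h (x + t *\<^sub>R u)) t :> deriv_at h (x + t *\<^sub>R u) u" if "0 \<le> t" "t \<le> s" for t
    by (intro has_real_derivative_along_line diff in_U that)
  from MVT2[OF s(1) this] obtain t where t: "0 < t" "t < s"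
    "h (x + s *\<^sub>R u) - h x = s * deriv_at h (x + t *\<^sub>R u) u"
    by auto
  moreover have "deriv_at h x u = 0"
    using deriv_at_local_max[OF U diff[OF U(2)] max] .
  ultimately have "h (x + s *\<^sub>R u) > h x"
    using d(2)[of t] s by (smt (verit) mult_pos_pos)
  then show False using max[OF in_U[of s]] s by simp
qed

section \<open>Linear algebra of an inner product\<close>

lemma inner_product_commute: "inner_product B \<Longrightarrow> B u v = B v u"
  unfolding inner_product_def by blast

lemma inner_product_pos: "inner_product B \<Longrightarrow> v \<noteq> 0 \<Longrightarrow> B v v > 0"
  unfolding inner_product_def by blast

lemma inner_product_bilinear: "inner_product B \<Longrightarrow> bilinear B"
  unfolding inner_product_def by blast

lemma inner_product_linear_right: "inner_product B \<Longrightarrow> linear (B u)"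
  unfolding inner_product_def bilinear_def by blast

lemma inner_product_linear_left: "inner_product B \<Longrightarrow> linear (\<lambda>u. B u v)"
  unfolding inner_product_def bilinear_def by blast

lemma inner_product_sum_left:
  assumes "inner_product B"
  shows "B (\<Sum>a\<in>A. c a *\<^sub>R f a) w = (\<Sum>a\<in>A. c a * B (f a) w)"
  using linear_sum[OF inner_product_linear_left[OF assms, of w], of "\<lambda>a. c a *\<^sub>R f a" A]
  by (simp add: bilinear_lmul[OF inner_product_bilinear[OF assms]])

lemma inner_product_eqI:
  assumes "inner_product B" "\<And>w. B u w = B v w"
  shows "u = v"
proof (rule ccontr)
  assume "u \<noteq> v"
  then have "B (u - v) (u - v) > 0" by (intro inner_product_pos[OF assms(1)]) auto
  moreover have "B (u - v) w = 0" for w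
    using assms(2) bilinear_lsub[OF inner_product_bilinear[OF assms(1)]] by simp
  ultimately show False by simp
qed

definition orthonormal :: "'e::euclidean_space bform \<Rightarrow> 'e set \<Rightarrow> bool" where
  "orthonormal B E \<longleftrightarrow> (\<forall>a\<in>E. \<forall>b\<in>E. B a b = of_bool (a = b))"

lemma orthonormal_coefficient:
  assumes "inner_product B" "orthonormal B E" "finite E" "e \<in> E"
  shows "B (\<Sum>a\<in>E. c a *\<^sub>R a) e = c e"
proof -
  have "B (\<Sum>a\<in>E. c a *\<^sub>R a) e = (\<Sum>a\<in>E. c a * B a e)"
    by (rule inner_product_sum_left[OF assms(1)])
  also have "\<dots> = (\<Sum>a\<in>E. if a = e then c a else 0)"
    using assms(2,4) by (intro sum.cong) (auto simp: orthonormal_def)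
  finally show ?thesis using assms(3,4) by simp
qed

lemma orthonormal_independent:
  assumes "inner_product B" "orthonormal B E" "finite E"
  shows "independent E"
proof (rule independent_if_scalars_zero[OF assms(3)])
  fix c e assume "(\<Sum>a\<in>E. c a *\<^sub>R a) = 0" "e \<in> E"
  then show "c e = 0"
    using orthonormal_coefficient[OF assms, of e c]
      linear_0[OF inner_product_linear_left[OF assms(1), of e]] by simp
qed

lemma orthonormal_expansion:
  assumes "inner_product B" "orthonormal B E" "finite E" "v \<in> span E"
  shows "v = (\<Sum>e\<in>E. B v e *\<^sub>R e)"
proof -
  obtain c where c: "v = (\<Sum>e\<in>E. c e *\<^sub>R e)"
    using assms(3,4) by (auto simp: span_finite)
  show ?thesis
    using orthonormal_coefficient[OF assms(1-3), of _ c] unfolding c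
    by (intro sum.cong) auto
qed

lemma orthonormal_residual:
  assumes "inner_product B" "orthonormal B E" "finite E" "w \<in> span E"
  shows "B (v - (\<Sum>e\<in>E. B v e *\<^sub>R e)) w = 0"
proof -
  let ?n = "v - (\<Sum>e\<in>E. B v e *\<^sub>R e)"
  have "B ?n e = 0" if "e \<in> E" for e
    using orthonormal_coefficient[OF assms(1-3) that, of "B v"]
      bilinear_lsub[OF inner_product_bilinear[OF assms(1)]] by simp
  then show ?thesis
    using linear_eq_0_on_span[OF inner_product_linear_right[OF assms(1), of ?n] _ assms(4)] by blast
qed

text \<open>Gram-Schmidt: as long as an orthonormal set does not span, a vector outside of its span has a
  nonzero residual, which after normalisation extends the set.\<close>

lemma orthonormal_set_of_card:
  fixes B :: "'e::euclidean_space bform"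
  assumes B: "inner_product B" and "n \<le> DIM('e)"
  shows "\<exists>E. finite E \<and> orthonormal B E \<and> card E = n"
  using assms(2)
proof (induction n)
  case 0
  have "finite ({}::'e set) \<and> orthonormal B {} \<and> card ({}::'e set) = 0"
    by (simp add: orthonormal_def)
  then show ?case by blast
next
  case (Suc n)
  then obtain E where E: "finite E" "orthonormal B E" "card E = n" by auto
  have "dim (span E) < DIM('e)"
    using dim_le_card'[OF E(1)] E(3) Suc.prems by simp
  then have "span E \<noteq> UNIV" by (metis dim_UNIV less_irrefl)
  then obtain v where v: "v \<notin> span E" by blast
  define w where "w = v - (\<Sum>e\<in>E. B v e *\<^sub>R e)"
  have "(\<Sum>e\<in>E. B v e *\<^sub>R e) \<in> span E"
    by (intro span_sum span_scale span_base)
  then have "w \<noteq> 0" using v by (auto simp: w_def)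
  then have pos: "B w w > 0" by (rule inner_product_pos[OF B])
  define z where "z = (1 / sqrt (B w w)) *\<^sub>R w"
  have w_orth: "B w e = 0" if "e \<in> E" for e
    unfolding w_def using orthonormal_residual[OF B E(2,1) span_base[OF that]] .
  have zz: "B z z = 1"
    using pos by (simp add: z_def bilinear_lmul[OF inner_product_bilinear[OF B]]
        bilinear_rmul[OF inner_product_bilinear[OF B]])
  have ze: "B z e = 0" "B e z = 0" if "e \<in> E" for e
    using w_orth[OF that] inner_product_commute[OF B, of e z]
    by (simp_all add: z_def bilinear_lmul[OF inner_product_bilinear[OF B]])
  have "z \<notin> E" using zz ze by force
  moreover have "orthonormal B (insert z E)"
    using E(2) zz ze \<open>z \<notin> E\<close> by (auto simp: orthonormal_def)
  ultimately show ?case using E(1,3) by (intro exI[of _ "insert z E"]) auto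
qed

lemma orthonormal_span_UNIV:
  fixes B :: "'e::euclidean_space bform"
  assumes "inner_product B" "orthonormal B E" "finite E" "card E = DIM('e)"
  shows "span E = UNIV"
  using card_ge_dim_independent[of E UNIV] orthonormal_independent[OF assms(1-3)] assms(4)
  by auto

lemma orthonormal_basis_exists:
  fixes B :: "'e::euclidean_space bform"
  assumes "inner_product B"
  obtains E where "finite E" "orthonormal B E" "card E = DIM('e)"
  using orthonormal_set_of_card[OF assms order.refl] by blast

lemma sharp_eqI:
  assumes "inner_product B" "\<And>w. B v w = \<alpha> w"
  shows "sharp B \<alpha> = v"
  unfolding sharp_def
  using assms(2) inner_product_eqI[OF assms(1)] by (intro the_equality) auto

lemma orthonormal_represents:
  fixes B :: "'e::euclidean_space bform"
  assumes B: "inner_product B" "orthonormal B E" "finite E" "card E = DIM('e)" and "linear \<alpha>"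
  shows "B (\<Sum>e\<in>E. \<alpha> e *\<^sub>R e) w = \<alpha> w"
proof -
  have w: "w = (\<Sum>e\<in>E. B w e *\<^sub>R e)"
    using orthonormal_expansion[OF B(1-3)] orthonormal_span_UNIV[OF B] by auto
  have "B (\<Sum>e\<in>E. \<alpha> e *\<^sub>R e) w = (\<Sum>e\<in>E. \<alpha> e * B e w)"
    by (rule inner_product_sum_left[OF B(1)])
  also have "\<dots> = (\<Sum>e\<in>E. \<alpha> (B w e *\<^sub>R e))"
    by (simp add: linear_cmul[OF assms(5)] inner_product_commute[OF B(1), of w] mult.commute)
  also have "\<dots> = \<alpha> (\<Sum>e\<in>E. B w e *\<^sub>R e)"
    by (rule linear_sum[OF assms(5), symmetric])
  finally show ?thesis using w by simp
qed

lemma sharp_orthonormal: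
  fixes B :: "'e::euclidean_space bform"
  assumes "inner_product B" "orthonormal B E" "finite E" "card E = DIM('e)" and "linear \<alpha>"
  shows "sharp B \<alpha> = (\<Sum>e\<in>E. \<alpha> e *\<^sub>R e)"
  using orthonormal_represents[OF assms] by (rule sharp_eqI[OF assms(1)])

lemma sharp_works:
  assumes "inner_product B" "linear \<alpha>"
  shows "B (sharp B \<alpha>) w = \<alpha> w"
  using orthonormal_basis_exists[OF assms(1)] sharp_orthonormal[OF assms(1) _ _ _ assms(2)]
    orthonormal_represents[OF assms(1) _ _ _ assms(2)] by metis

text \<open>The inverse metric has components $g^{ij} = \sum_e e^i e^j$ in terms of an orthonormal
  basis, so that the trace needs no inverse matrix once such a basis is chosen.\<close>

lemma metric_trace_orthonormal:
  fixes B :: "'e::euclidean_space bform" and T :: "'e \<Rightarrow> 'e \<Rightarrow> 'v::real_vector"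
  assumes B: "inner_product B" "orthonormal B E" "finite E" "card E = DIM('e)"
    and T: "\<And>v. linear (\<lambda>u. T u v)" "\<And>u. linear (T u)"
  shows "metric_trace B T = (\<Sum>e\<in>E. T e e)"
proof -
  have "metric_trace B T = (\<Sum>i\<in>Basis. T (\<Sum>e\<in>E. (e \<bullet> i) *\<^sub>R e) i)"
    unfolding metric_trace_def
    by (subst sharp_orthonormal[OF B])
      (auto intro: bounded_linear.linear bounded_linear_inner_left)
  also have "\<dots> = (\<Sum>i\<in>Basis. \<Sum>e\<in>E. (e \<bullet> i) *\<^sub>R T e i)"
    by (simp add: linear_sum[OF T(1)] linear_cmul[OF T(1)])
  also have "\<dots> = (\<Sum>e\<in>E. \<Sum>i\<in>Basis. T e ((e \<bullet> i) *\<^sub>R i))"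
    by (subst sum.swap) (simp add: linear_cmul[OF T(2)])
  also have "\<dots> = (\<Sum>e\<in>E. T e (\<Sum>i\<in>Basis. (e \<bullet> i) *\<^sub>R i))"
    by (simp add: linear_sum[OF T(2)])
  finally show ?thesis by (simp add: euclidean_representation)
qed

lemma normal_part_orthonormal:
  assumes B: "inner_product B" "orthonormal B E" "finite E"
  shows "normal_part B (span E) v = v - (\<Sum>e\<in>E. B v e *\<^sub>R e)"
  unfolding normal_part_def
proof (rule the_equality)
  show "v - (v - (\<Sum>e\<in>E. B v e *\<^sub>R e)) \<in> span E \<and>
      (\<forall>w\<in>span E. B (v - (\<Sum>e\<in>E. B v e *\<^sub>R e)) w = 0)"
    using orthonormal_residual[OF B] by (auto intro: span_sum span_scale span_base)
next
  fix n assume n: "v - n \<in> span E \<and> (\<forall>w\<in>span E. B n w = 0)"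
  have "B v e = B (v - n) e" if "e \<in> E" for e
    using n that bilinear_lsub[OF inner_product_bilinear[OF B(1)], of v n e]
    by (simp add: span_base)
  then have "v - n = (\<Sum>e\<in>E. B v e *\<^sub>R e)"
    using orthonormal_expansion[OF B, of "v - n"] n by simp
  then show "n = v - (\<Sum>e\<in>E. B v e *\<^sub>R e)" by (simp add: algebra_simps)
qed

lemma linear_cplx_J: "linear cplx_J"
  by (rule linearI) (simp_all add: cplx_J_def vec_eq_iff algebra_simps)

lemma cplx_J_cplx_J [simp]: "cplx_J (cplx_J v) = - v"
  by (simp add: cplx_J_def vec_eq_iff)

lemma cplx_J_eq_iff [simp]: "cplx_J u = cplx_J v \<longleftrightarrow> u = v"
  by (metis cplx_J_cplx_J neg_equal_iff_equal)

text \<open>An orthonormal basis of a Lagrangian subspace becomes, together with its image under \<open>\<i>\<close>,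
  an orthonormal basis of the whole space, and an
  invariant form takes the same values on \<open>e\<close> and \<open>\<i> e\<close>.\<close>

lemma metric_trace_lagrangian:
  fixes B :: "(complex^'m) bform" and T :: "complex^'m \<Rightarrow> complex^'m \<Rightarrow> real"
  assumes B: "inner_product B" "\<And>u v. B (cplx_J u) (cplx_J v) = B u v"
    and E: "orthonormal B E" "finite E" "card E = CARD('m)"
    and lagr: "\<And>a b. a \<in> E \<Longrightarrow> b \<in> E \<Longrightarrow> B (cplx_J a) b = 0"
    and T: "\<And>v. linear (\<lambda>u. T u v)" "\<And>u. linear (T u)"
      "\<And>u v. T (cplx_J u) (cplx_J v) = T u v"
  shows "metric_trace B T = 2 * (\<Sum>e\<in>E. T e e)"
proof -
  have disj: "E \<inter> cplx_J ` E = {}"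
  proof -
    have "B e e = 1" if "e \<in> E" for e using E(1) that by (simp add: orthonormal_def)
    then show ?thesis using lagr by force
  qed
  have inj: "inj_on cplx_J E" by (auto intro: inj_onI)
  have "orthonormal B (E \<union> cplx_J ` E)"
    using E(1) lagr inner_product_commute[OF B(1)] disj B(2)
    unfolding orthonormal_def by (auto simp: B(2))
  moreover have "card (E \<union> cplx_J ` E) = DIM(complex^'m)"
    using E(2,3) disj by (simp add: card_Un_disjoint card_image[OF inj])
  ultimately have "metric_trace B T = (\<Sum>e\<in>E \<union> cplx_J ` E. T e e)"
    using E(2) by (intro metric_trace_orthonormal[OF B(1) _ _ _ T(1,2)]) auto
  also have "\<dots> = (\<Sum>e\<in>E. T e e) + (\<Sum>e\<in>E. T (cplx_J e) (cplx_J e))"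
    using E(2) disj by (simp add: sum.union_disjoint sum.reindex[OF inj])
  finally show ?thesis by (simp add: T(3))
qed

section \<open>The dual vector of a smooth family of covectors\<close>

text \<open>The error in the product rule is \<open>c\<close> times the error of \<open>d\<close>, plus \<open>c - c x\<close> times a
  linear term; the latter is of smaller order by continuity of \<open>c\<close> alone.\<close>

lemma differentiable_mult_vanishing:
  fixes c d :: "'x::real_normed_vector \<Rightarrow> real"
  assumes c: "isCont c x" and d: "d differentiable (at x)" "d x = 0"
  shows "(\<lambda>y. c y * d y) differentiable (at x)"
proof -
  obtain D where D: "(d has_derivative D) (at x)"
    using d(1) by (auto simp: differentiable_def)
  then have bl: "bounded_linear D" by (rule has_derivative_bounded_linear)
  then obtain K where K: "\<And>v. norm (D v) \<le> norm v * K"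
    using bounded_linear.bounded by blast
  have lim1: "((\<lambda>y. (d y - D (y - x)) / norm (y - x)) \<longlongrightarrow> 0) (at x)"
    using D d(2) by (simp add: has_derivative_at_within divide_inverse_commute)
  have lim2: "((\<lambda>y. (c y - c x) * (D (y - x) / norm (y - x))) \<longlongrightarrow> 0) (at x)"
  proof (rule Lim_null_comparison)
    have "norm ((c y - c x) * (D (y - x) / norm (y - x))) \<le> \<bar>c y - c x\<bar> * K" if "y \<noteq> x" for y
    proof -
      have "\<bar>D (y - x) / norm (y - x)\<bar> \<le> K"
        using K[of "y - x"] that by (simp add: pos_divide_le_eq mult.commute)
      then show ?thesis by (simp only: real_norm_def abs_mult mult_left_mono abs_ge_zero)
    qed
    then show "\<forall>\<^sub>F y in at x. norm ((c y - c x) * (D (y - x) / norm (y - x))) \<le> \<bar>c y - c x\<bar> * K"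
      by (auto simp: eventually_at_filter)
    have "((\<lambda>y. \<bar>c y - c x\<bar> * K) \<longlongrightarrow> \<bar>c x - c x\<bar> * K) (at x)"
      using c by (intro tendsto_intros) (simp add: isCont_def)
    then show "((\<lambda>y. \<bar>c y - c x\<bar> * K) \<longlongrightarrow> 0) (at x)" by simp
  qed
  have "((\<lambda>y. c y * ((d y - D (y - x)) / norm (y - x)) + (c y - c x) * (D (y - x) / norm (y - x)))
      \<longlongrightarrow> c x * 0 + 0) (at x)"
    using c by (intro tendsto_intros lim1 lim2) (simp add: isCont_def)
  then have "((\<lambda>y. (c y * d y - c x * D (y - x)) / norm (y - x)) \<longlongrightarrow> 0) (at x)"
    by (simp add: field_simps diff_divide_distrib add_divide_distrib)
  then have "((\<lambda>y. c y * d y) has_derivative (\<lambda>v. c x * D v)) (at x)"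
    using bl d(2)
    by (simp add: has_derivative_at_within divide_inverse_commute bounded_linear_const_mult)
  then show ?thesis by (auto simp: differentiable_def)
qed

text \<open>In components with respect to a basis orthonormal at the point \<open>x\<close>, the equation
  \<open>G y (v y) w = \<alpha> y w\<close> for the dual vector reads \<open>c = \<alpha> - \<delta> c\<close> with a matrix \<open>\<delta>\<close> that
  vanishes at \<open>x\<close>. It bounds \<open>c\<close> near \<open>x\<close>, hence makes it continuous, and, read once
  more, differentiable.\<close>

lemma differentiable_sharp:
  fixes G :: "'x::real_normed_vector \<Rightarrow> 'e::euclidean_space bform"
  assumes S: "open S" "x \<in> S" and G: "\<And>y. y \<in> S \<Longrightarrow> inner_product (G y)"
    and diffG: "\<And>u v. (\<lambda>y. G y u v) differentiable (at x)"
    and \<alpha>: "\<And>y. y \<in> S \<Longrightarrow> linear (\<alpha> y)"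
    and diff\<alpha>: "\<And>w. (\<lambda>y. \<alpha> y w) differentiable (at x)"
  shows "(\<lambda>y. sharp (G y) (\<alpha> y)) differentiable (at x)"
proof -
  obtain E where E: "finite E" "orthonormal (G x) E" "card E = DIM('e)"
    using orthonormal_basis_exists[OF G[OF S(2)]] .
  define v where "v y = sharp (G y) (\<alpha> y)" for y
  define c where "c e y = G x (v y) e" for e y
  define \<delta> where "\<delta> a e y = G y a e - G x a e" for a e y
  have v: "v y = (\<Sum>a\<in>E. c a y *\<^sub>R a)" for y
    unfolding c_def using orthonormal_expansion[OF G[OF S(2)] E(2,1)]
      orthonormal_span_UNIV[OF G[OF S(2)] E(2,1,3)] by auto
  have c_eq: "c e y = \<alpha> y e - (\<Sum>a\<in>E. c a y * \<delta> a e y)" if y: "y \<in> S" for y e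
  proof -
    have "\<alpha> y e = G y (v y) e"
      unfolding v_def using sharp_works[OF G[OF y] \<alpha>[OF y]] by simp
    also have "\<dots> = (\<Sum>a\<in>E. c a y * G y a e)"
      by (subst v) (rule inner_product_sum_left[OF G[OF y]])
    also have "\<dots> = (\<Sum>a\<in>E. c a y * G x a e) + (\<Sum>a\<in>E. c a y * \<delta> a e y)"
      by (simp add: \<delta>_def algebra_simps flip: sum.distrib)
    also have "(\<Sum>a\<in>E. c a y * G x a e) = G x (v y) e"
      by (subst v) (rule inner_product_sum_left[OF G[OF S(2)], symmetric])
    finally show ?thesis by (simp add: c_def)
  qed
  have \<delta>: "(\<delta> a e) differentiable (at x)" "\<delta> a e x = 0" for a e
    unfolding \<delta>_def using diffG by (auto intro!: derivative_intros)
  have \<delta>_lim: "(\<delta> a e \<longlongrightarrow> 0) (at x)" for a e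
    using differentiable_imp_continuous_within[OF \<delta>(1)] \<delta>(2)
    by (simp add: continuous_within)
  have \<alpha>_lim: "((\<lambda>y. \<alpha> y e) \<longlongrightarrow> \<alpha> x e) (at x)" for e
    using differentiable_imp_continuous_within[OF diff\<alpha>] by (simp add: continuous_within)
  have ev_S: "\<forall>\<^sub>F y in at x. y \<in> S"
    using S eventually_at_topological by blast
  \<comment> \<open>the sum of the moduli of the components is at most twice that of the right-hand sides\<close>
  define M where "M = 2 * (\<Sum>e\<in>E. \<bar>\<alpha> x e\<bar>) + 1"
  have bound: "\<forall>\<^sub>F y in at x. \<forall>a\<in>E. \<bar>c a y\<bar> \<le> M"
  proof -
    have "((\<lambda>y. \<Sum>a\<in>E. \<Sum>e\<in>E. \<bar>\<delta> a e y\<bar>) \<longlongrightarrow> (\<Sum>a\<in>E. \<Sum>e\<in>E. \<bar>0\<bar>)) (at x)"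
      by (intro tendsto_intros \<delta>_lim)
    then have ev1: "\<forall>\<^sub>F y in at x. (\<Sum>a\<in>E. \<Sum>e\<in>E. \<bar>\<delta> a e y\<bar>) < 1/2"
      by (rule order_tendstoD) simp
    have "((\<lambda>y. 2 * (\<Sum>e\<in>E. \<bar>\<alpha> y e\<bar>)) \<longlongrightarrow> 2 * (\<Sum>e\<in>E. \<bar>\<alpha> x e\<bar>)) (at x)"
      by (intro tendsto_intros \<alpha>_lim)
    then have ev2: "\<forall>\<^sub>F y in at x. 2 * (\<Sum>e\<in>E. \<bar>\<alpha> y e\<bar>) < M"
      by (rule order_tendstoD) (simp add: M_def)
    from ev1 ev2 ev_S show ?thesis
    proof eventually_elim
      case (elim y)
      let ?m = "\<Sum>a\<in>E. \<bar>c a y\<bar>"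
      have le_m: "\<bar>c a y\<bar> \<le> ?m" if "a \<in> E" for a
        using member_le_sum[OF that, of "\<lambda>a. \<bar>c a y\<bar>"] E(1) by simp
      have m_nonneg: "?m \<ge> 0" by (rule sum_nonneg) simp
      have "?m \<le> (\<Sum>e\<in>E. \<bar>\<alpha> y e\<bar> + (\<Sum>a\<in>E. ?m * \<bar>\<delta> a e y\<bar>))"
      proof (rule sum_mono)
        fix e assume "e \<in> E"
        have "\<bar>\<Sum>a\<in>E. c a y * \<delta> a e y\<bar> \<le> (\<Sum>a\<in>E. \<bar>c a y * \<delta> a e y\<bar>)"
          by (rule sum_abs)
        also have "\<dots> \<le> (\<Sum>a\<in>E. ?m * \<bar>\<delta> a e y\<bar>)"
          by (intro sum_mono) (simp add: abs_mult mult_right_mono le_m)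
        finally show "\<bar>c e y\<bar> \<le> \<bar>\<alpha> y e\<bar> + (\<Sum>a\<in>E. ?m * \<bar>\<delta> a e y\<bar>)"
          using c_eq[OF elim(3), of e] by linarith
      qed
      also have "\<dots> = (\<Sum>e\<in>E. \<bar>\<alpha> y e\<bar>) + ?m * (\<Sum>a\<in>E. \<Sum>e\<in>E. \<bar>\<delta> a e y\<bar>)"
        using sum.swap[of "\<lambda>e a. ?m * \<bar>\<delta> a e y\<bar>" E E] by (simp add: sum.distrib sum_distrib_left)
      also have "\<dots> \<le> (\<Sum>e\<in>E. \<bar>\<alpha> y e\<bar>) + ?m * (1/2)"
        using elim(1) m_nonneg by (intro add_left_mono mult_left_mono) auto
      finally have "?m \<le> M" using elim(2) by linarith
      then show ?case using le_m by force
    qed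
  qed
  have c_lim: "isCont (c e) x" for e
  proof -
    have "((\<lambda>y. c a y * \<delta> a e y) \<longlongrightarrow> 0) (at x)" if a: "a \<in> E" for a
    proof (rule Lim_null_comparison)
      show "\<forall>\<^sub>F y in at x. norm (c a y * \<delta> a e y) \<le> M * \<bar>\<delta> a e y\<bar>"
        using bound by eventually_elim (simp add: abs_mult mult_right_mono a)
      show "((\<lambda>y. M * \<bar>\<delta> a e y\<bar>) \<longlongrightarrow> 0) (at x)"
        by (intro tendsto_mult_right_zero tendsto_rabs_zero \<delta>_lim)
    qed
    then have "((\<lambda>y. \<alpha> y e - (\<Sum>a\<in>E. c a y * \<delta> a e y)) \<longlongrightarrow> \<alpha> x e - (\<Sum>a\<in>E. 0)) (at x)"
      by (intro tendsto_intros \<alpha>_lim) auto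
    moreover have "c e x = \<alpha> x e - (\<Sum>a\<in>E. 0)"
      using c_eq[OF S(2), of e] by (simp add: \<delta>(2))
    ultimately have "((\<lambda>y. \<alpha> y e - (\<Sum>a\<in>E. c a y * \<delta> a e y)) \<longlongrightarrow> c e x) (at x)" by simp
    then have "(c e \<longlongrightarrow> c e x) (at x)"
      by (rule Lim_transform_eventually) (use ev_S in eventually_elim, simp flip: c_eq)
    then show ?thesis by (simp add: isCont_def)
  qed
  have "(\<lambda>y. \<Sum>e\<in>E. (\<alpha> y e - (\<Sum>a\<in>E. c a y * \<delta> a e y)) *\<^sub>R e) differentiable (at x)"
    using E(1) by (intro differentiable_sum ballI differentiable_scaleR differentiable_diff diff\<alpha>
        differentiable_const differentiable_mult_vanishing c_lim \<delta>) auto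
  then obtain D where
    "((\<lambda>y. \<Sum>e\<in>E. (\<alpha> y e - (\<Sum>a\<in>E. c a y * \<delta> a e y)) *\<^sub>R e) has_derivative D) (at x)"
    by (auto simp: differentiable_def)
  then have "(v has_derivative D) (at x)"
    by (rule has_derivative_transform_within_open[OF _ S]) (subst v, simp flip: c_eq)
  then show ?thesis unfolding v_def by (auto simp: differentiable_def)
qed

section \<open>Levi-Civita connection and curvature\<close>

definition metric_deriv :: "('e::euclidean_space \<Rightarrow> 'e bform) \<Rightarrow> 'e \<Rightarrow> 'e \<Rightarrow> 'e \<Rightarrow> 'e \<Rightarrow> real" where
  "metric_deriv g x a u v = deriv_at (\<lambda>y. g y u v) x a"

definition christoffel_deriv ::
  "('e::euclidean_space \<Rightarrow> 'e bform) \<Rightarrow> 'e \<Rightarrow> 'e \<Rightarrow> 'e \<Rightarrow> 'e \<Rightarrow> 'e" where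
  "christoffel_deriv g x a u v = deriv_at (\<lambda>y. christoffel g y u v) x a"

lemma linear_transform:
  assumes "linear f" "\<And>v. h v = f v"
  shows "linear h"
proof -
  have "h = f" using assms(2) by (rule ext)
  then show ?thesis using assms(1) by simp
qed

lemma curvature_alt:
  "curvature g x u v w = christoffel_deriv g x u v w - christoffel_deriv g x v u w
     + christoffel g x u (christoffel g x v w) - christoffel g x v (christoffel g x u w)"
  unfolding curvature_def christoffel_deriv_def ..

lemma curvature_antisym: "curvature g x u v w = - curvature g x v u w"
  by (simp add: curvature_alt)

lemma pair_symmetry_of_curvature_like:
  fixes K :: "'e \<Rightarrow> 'e \<Rightarrow> 'e \<Rightarrow> 'e \<Rightarrow> real"
  assumes "\<And>u v w z. K u v w z = - K v u w z" "\<And>u v w z. K u v w z = - K u v z w"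
    and "\<And>u v w z. K u v w z + K v w u z + K w u v z = 0"
  shows "K u v w z = K w z u v"
proof -
  \<comment> \<open>the cyclic identities with the last argument running over \<open>z, u, v, w\<close>,
    rewritten by the antisymmetries\<close>
  have "K u v w z + K v w u z + K w u v z = 0"
    "- K v w u z - K w z u v + K v z u w = 0"
    "K w z u v - K z u v w + K w u v z = 0"
    "K z u v w - K u v w z + K v z u w = 0"
    using assms(3)[of u v w z] assms(3)[of v w z u] assms(3)[of w z u v] assms(3)[of z u v w]
      assms(2)[of v w z u] assms(2)[of w z v u] assms(1)[of z v w u] assms(2)[of v z w u]
      assms(2)[of z u w v] assms(1)[of u w z v] assms(2)[of w u z v] assms(2)[of u v z w]
    by simp_all
  then show ?thesis by linarith
qed

locale coord_metric =
  fixes S :: "'e::euclidean_space set" and g :: "'e \<Rightarrow> 'e bform"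
  assumes open_S: "open S"
    and inner: "x \<in> S \<Longrightarrow> inner_product (g x)"
    and smooth: "smooth_on S (\<lambda>x. g x u v)"
begin

lemma has_derivative_metric:
  "x \<in> S \<Longrightarrow> ((\<lambda>y. g y u v) has_derivative (\<lambda>a. metric_deriv g x a u v)) (at x)"
  using has_derivative_deriv_at[OF smooth_on_imp_differentiable[OF smooth]]
  by (simp add: metric_deriv_def[abs_def])

lemma metric_deriv_commute:
  assumes "x \<in> S"
  shows "metric_deriv g x a u v = metric_deriv g x a v u"
  unfolding metric_deriv_def
  by (rule fun_cong[OF deriv_at_cong[OF open_S assms]]) (rule inner_product_commute[OF inner])

lemma metric_deriv_linear1: "x \<in> S \<Longrightarrow> linear (\<lambda>a. metric_deriv g x a u v)"
  by (rule has_derivative_linear[OF has_derivative_metric])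

lemma metric_deriv_linear2:
  assumes x: "x \<in> S"
  shows "linear (\<lambda>u. metric_deriv g x a u v)"
proof (rule linearI)
  fix u u' :: 'e and r :: real
  have "((\<lambda>y. g y (u + u') v) has_derivative
      (\<lambda>a. metric_deriv g x a u v + metric_deriv g x a u' v)) (at x)"
    by (rule has_derivative_transform_within_open
        [OF has_derivative_add[OF has_derivative_metric[OF x] has_derivative_metric[OF x]] open_S x])
      (simp add: bilinear_ladd[OF inner_product_bilinear[OF inner]])
  then show "metric_deriv g x a (u + u') v = metric_deriv g x a u v + metric_deriv g x a u' v"
    by (simp add: metric_deriv_def[of g x a "u + u'"] deriv_at_eqI)
  have "((\<lambda>y. g y (r *\<^sub>R u) v) has_derivative (\<lambda>a. r *\<^sub>R metric_deriv g x a u v)) (at x)"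
    by (rule has_derivative_transform_within_open
        [OF has_derivative_scaleR_right[OF has_derivative_metric[OF x]] open_S x])
      (simp add: bilinear_lmul[OF inner_product_bilinear[OF inner]])
  then show "metric_deriv g x a (r *\<^sub>R u) v = r *\<^sub>R metric_deriv g x a u v"
    by (simp add: metric_deriv_def[of g x a "r *\<^sub>R u"] deriv_at_eqI)
qed

lemma metric_deriv_linear3:
  assumes "x \<in> S"
  shows "linear (metric_deriv g x a u)"
  by (rule linear_transform[OF metric_deriv_linear2[OF assms]]) (rule metric_deriv_commute[OF assms])

lemmas metric_deriv_minus =
  linear_neg[OF metric_deriv_linear1] linear_neg[OF metric_deriv_linear2]
  linear_neg[OF metric_deriv_linear3]

lemma koszul_linear:
  assumes "x \<in> S"
  shows "linear (\<lambda>w. (metric_deriv g x u v w + metric_deriv g x v u w - metric_deriv g x w u v) / 2)"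
  by (rule linearI)
    (simp_all add: linear_add[OF metric_deriv_linear1[OF assms]]
      linear_cmul[OF metric_deriv_linear1[OF assms]] linear_add[OF metric_deriv_linear3[OF assms]]
      linear_cmul[OF metric_deriv_linear3[OF assms]] right_diff_distrib distrib_left
      add_divide_distrib diff_divide_distrib)

lemma koszul:
  assumes "x \<in> S"
  shows "g x (christoffel g x u v) w =
    (metric_deriv g x u v w + metric_deriv g x v u w - metric_deriv g x w u v) / 2"
  unfolding christoffel_def
  using sharp_works[OF inner[OF assms] koszul_linear[OF assms], of u v w]
  by (simp add: metric_deriv_def)

lemma christoffel_commute:
  assumes "x \<in> S"
  shows "christoffel g x u v = christoffel g x v u"
  by (rule inner_product_eqI[OF inner[OF assms]])
    (simp add: koszul[OF assms] metric_deriv_commute[OF assms, of _ u v])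

lemma christoffel_linear2:
  assumes x: "x \<in> S"
  shows "linear (christoffel g x u)"
proof (rule linearI)
  fix v v' and r :: real
  note add = linear_add[OF metric_deriv_linear1[OF x]] linear_add[OF metric_deriv_linear2[OF x]]
    linear_add[OF metric_deriv_linear3[OF x]]
  note cmul = linear_cmul[OF metric_deriv_linear1[OF x]] linear_cmul[OF metric_deriv_linear2[OF x]]
    linear_cmul[OF metric_deriv_linear3[OF x]]
  show "christoffel g x u (v + v') = christoffel g x u v + christoffel g x u v'"
    by (rule inner_product_eqI[OF inner[OF x]])
      (simp add: koszul[OF x] bilinear_ladd[OF inner_product_bilinear[OF inner[OF x]]]
        add add_divide_distrib diff_divide_distrib)
  show "christoffel g x u (r *\<^sub>R v) = r *\<^sub>R christoffel g x u v"
    by (rule inner_product_eqI[OF inner[OF x]])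
      (simp add: koszul[OF x] bilinear_lmul[OF inner_product_bilinear[OF inner[OF x]]]
        cmul right_diff_distrib distrib_left add_divide_distrib diff_divide_distrib)
qed

lemma christoffel_linear1:
  assumes "x \<in> S"
  shows "linear (\<lambda>u. christoffel g x u v)"
  by (rule linear_transform[OF christoffel_linear2[OF assms]]) (rule christoffel_commute[OF assms])

lemma metric_compatible:
  assumes "x \<in> S"
  shows "metric_deriv g x a u v = g x (christoffel g x a u) v + g x (christoffel g x a v) u"
  by (simp add: koszul[OF assms] metric_deriv_commute[OF assms, of _ v] field_simps)

lemma christoffel_differentiable:
  assumes "x \<in> S"
  shows "(\<lambda>y. christoffel g y u v) differentiable (at x)"
  unfolding christoffel_def
proof (rule differentiable_sharp[OF open_S assms inner])
  show "(\<lambda>y. g y a b) differentiable (at x)" for a b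
    using smooth_on_imp_differentiable[OF smooth assms] .
  show "linear (\<lambda>w. (deriv_at (\<lambda>y. g y v w) y u + deriv_at (\<lambda>y. g y u w) y v
      - deriv_at (\<lambda>y. g y u v) y w) / 2)" if "y \<in> S" for y
    using koszul_linear[OF that, of u v] by (simp add: metric_deriv_def)
  show "(\<lambda>y. (deriv_at (\<lambda>y. g y v w) y u + deriv_at (\<lambda>y. g y u w) y v
      - deriv_at (\<lambda>y. g y u v) y w) / 2) differentiable (at x)" for w
    by (intro differentiable_divide differentiable_diff differentiable_add differentiable_const
        smooth_on_imp_differentiable[OF smooth_on_deriv_at[OF smooth] assms]) simp
qed

lemma has_derivative_christoffel:
  "x \<in> S \<Longrightarrow> ((\<lambda>y. christoffel g y u v) has_derivative (\<lambda>a. christoffel_deriv g x a u v)) (at x)"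
  using has_derivative_deriv_at[OF christoffel_differentiable]
  by (simp add: christoffel_deriv_def[abs_def])

lemma christoffel_deriv_linear1: "x \<in> S \<Longrightarrow> linear (\<lambda>a. christoffel_deriv g x a u v)"
  by (rule has_derivative_linear[OF has_derivative_christoffel])

lemma christoffel_deriv_commute:
  assumes "x \<in> S"
  shows "christoffel_deriv g x a u v = christoffel_deriv g x a v u"
  unfolding christoffel_deriv_def
  by (rule fun_cong[OF deriv_at_cong[OF open_S assms]]) (rule christoffel_commute)

lemma christoffel_deriv_linear3:
  assumes x: "x \<in> S"
  shows "linear (christoffel_deriv g x a u)"
proof (rule linearI)
  fix v v' :: 'e and r :: real
  have "((\<lambda>y. christoffel g y u (v + v')) has_derivative
      (\<lambda>a. christoffel_deriv g x a u v + christoffel_deriv g x a u v')) (at x)"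
    by (rule has_derivative_transform_within_open[OF has_derivative_add
          [OF has_derivative_christoffel[OF x] has_derivative_christoffel[OF x]] open_S x])
      (simp add: linear_add[OF christoffel_linear2])
  then show "christoffel_deriv g x a u (v + v')
      = christoffel_deriv g x a u v + christoffel_deriv g x a u v'"
    by (simp add: christoffel_deriv_def[of g x a u "v + v'"] deriv_at_eqI)
  have "((\<lambda>y. christoffel g y u (r *\<^sub>R v)) has_derivative
      (\<lambda>a. r *\<^sub>R christoffel_deriv g x a u v)) (at x)"
    by (rule has_derivative_transform_within_open
        [OF has_derivative_scaleR_right[OF has_derivative_christoffel[OF x]] open_S x])
      (simp add: linear_cmul[OF christoffel_linear2])
  then show "christoffel_deriv g x a u (r *\<^sub>R v) = r *\<^sub>R christoffel_deriv g x a u v"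
    by (simp add: christoffel_deriv_def[of g x a u "r *\<^sub>R v"] deriv_at_eqI)
qed

lemma christoffel_deriv_linear2:
  assumes "x \<in> S"
  shows "linear (\<lambda>u. christoffel_deriv g x a u v)"
  by (rule linear_transform[OF christoffel_deriv_linear3[OF assms]]) (rule christoffel_deriv_commute[OF assms])

lemma curvature_linear1: "x \<in> S \<Longrightarrow> linear (\<lambda>u. curvature g x u v w)"
  unfolding curvature_alt
  by (intro linear_compose_add linear_compose_sub christoffel_deriv_linear1 christoffel_deriv_linear2
      christoffel_linear1 linear_compose[OF christoffel_linear1 christoffel_linear2, unfolded o_def])

lemma curvature_linear2:
  assumes "x \<in> S"
  shows "linear (\<lambda>v. curvature g x u v w)"
  by (rule linear_transform[OF linear_compose_neg[OF curvature_linear1[OF assms]]])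
    (rule curvature_antisym)

lemma curvature_linear3: "x \<in> S \<Longrightarrow> linear (curvature g x u v)"
  unfolding curvature_alt[abs_def]
  by (intro linear_compose_add linear_compose_sub christoffel_deriv_linear3
      linear_compose[OF christoffel_linear2 christoffel_linear2, unfolded o_def])

lemma has_derivative_metric_field:
  assumes x: "x \<in> S" and X: "(X has_derivative X') (at x)"
  shows "((\<lambda>y. g y (X y) w) has_derivative (\<lambda>a. metric_deriv g x a (X x) w + g x (X' a) w)) (at x)"
proof -
  have expand: "T u = (\<Sum>i\<in>Basis. (u \<bullet> i) * T i)" if "linear T" for T :: "'e \<Rightarrow> real" and u
    using linear_sum[OF that, of "\<lambda>i. (u \<bullet> i) *\<^sub>R i" Basis]
    by (simp add: euclidean_representation linear_cmul[OF that])
  have g: "g y u w = (\<Sum>i\<in>Basis. (u \<bullet> i) * g y i w)" if "y \<in> S" for y u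
    using expand[OF inner_product_linear_left[OF inner[OF that]]] .
  \<comment> \<open>expansion over the basis turns the moving vector into real factors of a product\<close>
  have "((\<lambda>y. \<Sum>i\<in>Basis. (X y \<bullet> i) * g y i w) has_derivative
      (\<lambda>a. \<Sum>i\<in>Basis. (X x \<bullet> i) * metric_deriv g x a i w + (X' a \<bullet> i) * g x i w)) (at x)"
    by (intro has_derivative_sum has_derivative_mult has_derivative_metric x
        has_derivative_inner_left X)
  then have "((\<lambda>y. g y (X y) w) has_derivative
      (\<lambda>a. \<Sum>i\<in>Basis. (X x \<bullet> i) * metric_deriv g x a i w + (X' a \<bullet> i) * g x i w)) (at x)"
    by (rule has_derivative_transform_within_open[OF _ open_S x]) (simp flip: g)
  moreover have "(\<Sum>i\<in>Basis. (X x \<bullet> i) * metric_deriv g x a i w + (X' a \<bullet> i) * g x i w)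
      = metric_deriv g x a (X x) w + g x (X' a) w" for a
    unfolding sum.distrib
    by (intro arg_cong2[where f = "(+)"] expand[OF metric_deriv_linear2[OF x], symmetric]
        g[OF x, symmetric])
  ultimately show ?thesis by simp
qed

text \<open>Differentiating metric compatibility once more and antisymmetrising in the two directions of
  differentiation: the left-hand side vanishes by Schwarz' theorem and the products of two
  Christoffel terms cancel.\<close>

lemma curvature_skew_adjoint:
  assumes x: "x \<in> S"
  shows "g x (curvature g x u v w) z = - g x (curvature g x u v z) w"
proof -
  let ?\<Gamma> = "christoffel g x" and ?d\<Gamma> = "christoffel_deriv g x"
  note B = inner_product_bilinear[OF inner[OF x]]
  have second: "deriv2_at (\<lambda>y. g y w z) x b a =
      g x (?\<Gamma> b (?\<Gamma> a w)) z + g x (?\<Gamma> b z) (?\<Gamma> a w) + g x (?d\<Gamma> b a w) z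
      + (g x (?\<Gamma> b (?\<Gamma> a z)) w + g x (?\<Gamma> b w) (?\<Gamma> a z) + g x (?d\<Gamma> b a z) w)" for a b
  proof -
    have "((\<lambda>y. g y (christoffel g y a w) z + g y (christoffel g y a z) w) has_derivative
        (\<lambda>b. (metric_deriv g x b (?\<Gamma> a w) z + g x (?d\<Gamma> b a w) z)
          + (metric_deriv g x b (?\<Gamma> a z) w + g x (?d\<Gamma> b a z) w))) (at x)"
      by (intro has_derivative_add has_derivative_metric_field has_derivative_christoffel x)
    then have "((\<lambda>y. deriv_at (\<lambda>y. g y w z) y a) has_derivative
        (\<lambda>b. (metric_deriv g x b (?\<Gamma> a w) z + g x (?d\<Gamma> b a w) z)
          + (metric_deriv g x b (?\<Gamma> a z) w + g x (?d\<Gamma> b a z) w))) (at x)"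
      by (rule has_derivative_transform_within_open[OF _ open_S x])
        (simp add: metric_compatible flip: metric_deriv_def)
    then show ?thesis
      unfolding deriv2_at_def
      by (simp add: deriv_at_eqI metric_compatible[OF x])
  qed
  have "deriv2_at (\<lambda>y. g y w z) x u v = deriv2_at (\<lambda>y. g y w z) x v u"
    by (rule deriv2_at_commute[OF open_S x smooth])
  then show ?thesis
    unfolding second curvature_alt
    by (simp add: bilinear_ladd[OF B] bilinear_lsub[OF B]
        inner_product_commute[OF inner[OF x], of "?\<Gamma> v w" "?\<Gamma> u z"]
        inner_product_commute[OF inner[OF x], of "?\<Gamma> v z" "?\<Gamma> u w"])
qed

lemma bianchi:
  assumes "x \<in> S"
  shows "curvature g x u v w + curvature g x v w u + curvature g x w u v = 0"
  by (simp add: curvature_alt christoffel_deriv_commute[OF assms, of u w v]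
      christoffel_deriv_commute[OF assms, of v w u] christoffel_deriv_commute[OF assms, of w v u]
      christoffel_commute[OF assms, of w v] christoffel_commute[OF assms, of w u]
      christoffel_commute[OF assms, of v u])

lemma curvature_pair_symmetry:
  assumes x: "x \<in> S"
  shows "g x (curvature g x u v w) z = g x (curvature g x w z u) v"
proof (rule pair_symmetry_of_curvature_like[of "\<lambda>u v w z. g x (curvature g x u v w) z"])
  note B = inner_product_bilinear[OF inner[OF x]]
  show "g x (curvature g x u v w) z = - g x (curvature g x v u w) z" for u v w z
    by (subst curvature_antisym) (simp add: bilinear_lneg[OF B])
  show "g x (curvature g x u v w) z = - g x (curvature g x u v z) w" for u v w z
    by (rule curvature_skew_adjoint[OF x])
  show "g x (curvature g x u v w) z + g x (curvature g x v w u) z + g x (curvature g x w u v) z = 0"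
    for u v w z
  proof -
    have "g x (curvature g x u v w + curvature g x v w u + curvature g x w u v) z = 0"
      by (simp only: bianchi[OF x] bilinear_lzero[OF B])
    then show ?thesis by (simp add: bilinear_ladd[OF B])
  qed
qed

lemma ricci_linear1: "x \<in> S \<Longrightarrow> linear (\<lambda>v. ricci g x v w)"
  unfolding ricci_def
  by (intro linear_compose_sum ballI linear_compose[OF curvature_linear2, unfolded o_def]
      bounded_linear.linear bounded_linear_inner_left)

lemma ricci_linear2: "x \<in> S \<Longrightarrow> linear (ricci g x v)"
  unfolding ricci_def[abs_def]
  by (intro linear_compose_sum ballI linear_compose[OF curvature_linear3, unfolded o_def]
      bounded_linear.linear bounded_linear_inner_left)

end

section \<open>Curvature of a Kaehler metric\<close>

text \<open>The last axiom is closedness of the Kaehler form \<open>\<omega>(u,v) = g(Ju,v)\<close>.\<close>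

locale coord_kaehler = coord_metric S g
  for S :: "(complex^'m) set" and g :: "complex^'m \<Rightarrow> (complex^'m) bform" +
  assumes hermitian: "x \<in> S \<Longrightarrow> g x (cplx_J u) (cplx_J v) = g x u v"
    and closed: "x \<in> S \<Longrightarrow> metric_deriv g x u (cplx_J v) w + metric_deriv g x v (cplx_J w) u
      + metric_deriv g x w (cplx_J u) v = 0"
begin

lemma hermitian_skew: "x \<in> S \<Longrightarrow> g x (cplx_J u) v = - g x u (cplx_J v)"
  using hermitian[of x u "cplx_J v"] bilinear_rneg[OF inner_product_bilinear[OF inner]] by auto

lemma metric_deriv_skew:
  assumes "x \<in> S"
  shows "metric_deriv g x a (cplx_J u) v = - metric_deriv g x a u (cplx_J v)"
proof -
  have "((\<lambda>y. g y (cplx_J u) v) has_derivative (\<lambda>a. - metric_deriv g x a u (cplx_J v))) (at x)"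
    by (rule has_derivative_transform_within_open
        [OF has_derivative_minus[OF has_derivative_metric[OF assms]] open_S assms])
      (simp add: hermitian_skew)
  then show ?thesis
    by (simp add: metric_deriv_def[of g x a "cplx_J u"] deriv_at_eqI)
qed

text \<open>The complex structure is parallel: \<open>d\<omega>(u,v,w) = 0\<close> and \<open>d\<omega>(u, Jw, Jv) = 0\<close> together say
  that \<open>g(\<Gamma>(u,Jv) - J \<Gamma>(u,v), w)\<close>, expanded by the Koszul formula, vanishes.\<close>

lemma christoffel_J:
  assumes x: "x \<in> S"
  shows "christoffel g x u (cplx_J v) = cplx_J (christoffel g x u v)"
proof (rule inner_product_eqI[OF inner[OF x]])
  fix w
  let ?D = "metric_deriv g x"
  note J = metric_deriv_skew[OF x] metric_deriv_minus[OF x]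
  have "?D u (cplx_J v) w + ?D v (cplx_J w) u + ?D w (cplx_J u) v = 0"
    by (rule closed[OF x])
  moreover have "- ?D u w (cplx_J v) - ?D (cplx_J w) v u + ?D (cplx_J v) u w = 0"
    using closed[OF x, of u "cplx_J w" "cplx_J v"] by (simp add: J)
  moreover have "?D u (cplx_J v) w = - ?D u v (cplx_J w)" "?D v (cplx_J w) u = - ?D v w (cplx_J u)"
    "?D w (cplx_J u) v = - ?D w u (cplx_J v)" "?D v (cplx_J u) w = - ?D v u (cplx_J w)"
    by (simp_all add: J)
  moreover have "?D v (cplx_J u) w = ?D v w (cplx_J u)" "?D u (cplx_J v) w = ?D u w (cplx_J v)"
    "?D (cplx_J w) u v = ?D (cplx_J w) v u"
    by (rule metric_deriv_commute[OF x])+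
  ultimately have "g x (christoffel g x u (cplx_J v)) w = - g x (christoffel g x u v) (cplx_J w)"
    unfolding koszul[OF x] by (simp add: field_simps)
  then show "g x (christoffel g x u (cplx_J v)) w = g x (cplx_J (christoffel g x u v)) w"
    by (simp add: hermitian_skew[OF x])
qed

lemma christoffel_deriv_J:
  assumes x: "x \<in> S"
  shows "christoffel_deriv g x a u (cplx_J v) = cplx_J (christoffel_deriv g x a u v)"
proof -
  have "((\<lambda>y. christoffel g y u (cplx_J v)) has_derivative
      (\<lambda>a. cplx_J (christoffel_deriv g x a u v))) (at x)"
    by (rule has_derivative_transform_within_open[OF bounded_linear.has_derivative
          [OF linear_linear[THEN iffD2, OF linear_cplx_J] has_derivative_christoffel[OF x]] open_S x])
      (simp add: christoffel_J)
  then show ?thesis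
    by (simp add: christoffel_deriv_def[of g x a u "cplx_J v"] deriv_at_eqI)
qed

lemma curvature_J:
  "x \<in> S \<Longrightarrow> curvature g x u v (cplx_J w) = cplx_J (curvature g x u v w)"
  by (simp add: curvature_alt christoffel_deriv_J christoffel_J
      linear_add[OF linear_cplx_J] linear_diff[OF linear_cplx_J])

text \<open>By pair symmetry, commuting with \<open>J\<close> in the last argument becomes invariance in the first two.\<close>

lemma curvature_J_J:
  assumes x: "x \<in> S"
  shows "curvature g x (cplx_J u) (cplx_J v) w = curvature g x u v w"
proof (rule inner_product_eqI[OF inner[OF x]])
  fix z
  have "g x (curvature g x (cplx_J u) (cplx_J v) w) z = g x (curvature g x w z (cplx_J u)) (cplx_J v)"
    by (rule curvature_pair_symmetry[OF x])
  also have "\<dots> = g x (curvature g x w z u) v"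
    by (simp add: curvature_J[OF x] hermitian[OF x])
  also have "\<dots> = g x (curvature g x u v w) z"
    by (rule curvature_pair_symmetry[OF x])
  finally show "g x (curvature g x (cplx_J u) (cplx_J v) w) z = g x (curvature g x u v w) z" .
qed

end

lemma inner_cplx_J_cplx_J: "cplx_J u \<bullet> cplx_J v = u \<bullet> v"
  by (simp add: cplx_J_def inner_vec_def inner_complex_def add.commute)

lemma inner_product_inner: "inner_product ((\<bullet>) :: 'e::euclidean_space bform)"
  by (simp add: inner_product_def bilinear_def inner_commute bounded_linear.linear
      bounded_linear_inner_left bounded_linear_inner_right)

text \<open>The coordinate trace may be taken over the basis \<open>\<i> b\<close>, since multiplication by \<open>\<i>\<close> is an
  isometry of the standard inner product.\<close>

lemma trace_conjugate_J:
  fixes A :: "complex^'m \<Rightarrow> complex^'m"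
  assumes "linear A"
  shows "(\<Sum>i\<in>Basis. A (cplx_J i) \<bullet> cplx_J i) = (\<Sum>i\<in>Basis. A i \<bullet> i)"
proof -
  have T: "linear (\<lambda>u. A u \<bullet> v)" "linear ((\<bullet>) (A u))" for u v
    using linear_compose[OF assms, of "\<lambda>u. u \<bullet> v"]
    by (auto simp: o_def bounded_linear.linear bounded_linear_inner_left bounded_linear_inner_right)
  have inj: "inj_on cplx_J (Basis :: (complex^'m) set)" by (auto intro: inj_onI)
  have "orthonormal (\<bullet>) (Basis :: (complex^'m) set)"
    by (auto simp: orthonormal_def inner_Basis)
  moreover from this have "orthonormal (\<bullet>) (cplx_J ` (Basis :: (complex^'m) set))"
    by (auto simp: orthonormal_def inner_cplx_J_cplx_J)
  ultimately have "(\<Sum>i\<in>Basis. A i \<bullet> i) = (\<Sum>i\<in>cplx_J ` Basis. A i \<bullet> i)"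
    using metric_trace_orthonormal[OF inner_product_inner _ _ _ T, of Basis]
      metric_trace_orthonormal[OF inner_product_inner _ _ _ T, of "cplx_J ` Basis"]
    by (simp add: card_image[OF inj])
  then show ?thesis by (simp add: sum.reindex[OF inj])
qed

context coord_kaehler
begin

text \<open>The map \<open>u \<mapsto> R(u, Jv) Jw\<close>, conjugated by \<open>J\<close>, is \<open>u \<mapsto> R(u, v) w\<close>, and conjugation preserves
  the trace.\<close>

lemma ricci_J_J:
  assumes x: "x \<in> S"
  shows "ricci g x (cplx_J v) (cplx_J w) = ricci g x v w"
proof -
  have "ricci g x (cplx_J v) (cplx_J w)
      = (\<Sum>i\<in>Basis. curvature g x (cplx_J i) (cplx_J v) (cplx_J w) \<bullet> cplx_J i)"
    unfolding ricci_def using trace_conjugate_J[OF curvature_linear1[OF x]] by simp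
  also have "\<dots> = ricci g x v w"
    by (simp add: ricci_def curvature_J_J[OF x] curvature_J[OF x] inner_cplx_J_cplx_J)
  finally show ?thesis .
qed

end

section \<open>The trace of the Hessian along a submanifold\<close>

lemma deriv2_at_linear1: "smooth_on S f \<Longrightarrow> x \<in> S \<Longrightarrow> linear (\<lambda>u. deriv2_at f x u v)"
  by (rule has_derivative_linear[OF smooth_on_deriv2])

lemma deriv2_at_linear2:
  assumes S: "open S" "x \<in> S" and f: "smooth_on S f"
  shows "linear (deriv2_at f x u)"
proof (rule linearI)
  fix v w and r :: real
  have lin: "linear (deriv_at f y)" if "y \<in> S" for y
    by (rule linear_frechet_derivative[OF smooth_on_imp_differentiable[OF f that]])
  have "((\<lambda>y. deriv_at f y (v + w)) has_derivative (\<lambda>u. deriv2_at f x u v + deriv2_at f x u w)) (at x)"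
    by (rule has_derivative_transform_within_open[OF has_derivative_add
          [OF smooth_on_deriv2[OF f S(2)] smooth_on_deriv2[OF f S(2)]] S])
      (simp add: linear_add[OF lin])
  then show "deriv2_at f x u (v + w) = deriv2_at f x u v + deriv2_at f x u w"
    by (simp add: deriv2_at_def[of f x u "v + w"] deriv_at_eqI)
  have "((\<lambda>y. deriv_at f y (r *\<^sub>R v)) has_derivative (\<lambda>u. r *\<^sub>R deriv2_at f x u v)) (at x)"
    by (rule has_derivative_transform_within_open
        [OF has_derivative_scaleR_right[OF smooth_on_deriv2[OF f S(2)]] S])
      (simp add: linear_cmul[OF lin])
  then show "deriv2_at f x u (r *\<^sub>R v) = r *\<^sub>R deriv2_at f x u v"
    by (simp add: deriv2_at_def[of f x u "r *\<^sub>R v"] deriv_at_eqI)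
qed

locale smooth_composition =
  fixes U :: "'d::euclidean_space set" and S :: "'e::euclidean_space set"
    and F :: "'d \<Rightarrow> 'e" and \<phi> :: "'e \<Rightarrow> real"
  assumes open_U: "open U" and open_target: "open S" and F_in: "y \<in> U \<Longrightarrow> F y \<in> S"
    and F: "smooth_on U F" and \<phi>: "smooth_on S \<phi>"
begin

lemma has_derivative_comp:
  assumes "x \<in> U"
  shows "((\<lambda>y. \<phi> (F y)) has_derivative (\<lambda>v. deriv_at \<phi> (F x) (deriv_at F x v))) (at x)"
  by (rule has_derivative_compose)
    (intro has_derivative_deriv_at smooth_on_imp_differentiable[OF F assms]
      smooth_on_imp_differentiable[OF \<phi> F_in[OF assms]])+

lemma deriv_at_comp:
  "x \<in> U \<Longrightarrow> deriv_at (\<lambda>y. \<phi> (F y)) x v = deriv_at \<phi> (F x) (deriv_at F x v)"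
  by (simp add: deriv_at_eqI[OF has_derivative_comp])

lemma has_derivative_deriv_comp:
  assumes x: "x \<in> U"
  shows "((\<lambda>y. deriv_at (\<lambda>y. \<phi> (F y)) y v) has_derivative
    (\<lambda>u. deriv2_at \<phi> (F x) (deriv_at F x u) (deriv_at F x v)
      + deriv_at \<phi> (F x) (deriv2_at F x u v))) (at x)"
proof -
  have expand: "(\<Sum>i\<in>Basis. (u \<bullet> i) * T i) = T u" if "linear T" for T :: "'e \<Rightarrow> real" and u
    using linear_sum[OF that, of "\<lambda>i. (u \<bullet> i) *\<^sub>R i" Basis]
    by (simp add: euclidean_representation linear_cmul[OF that])
  have lin: "linear (deriv_at \<phi> (F y))" if "y \<in> U" for y
    by (rule linear_frechet_derivative[OF smooth_on_imp_differentiable[OF \<phi> F_in[OF that]]])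
  have D: "((\<lambda>y. deriv_at \<phi> (F y) i) has_derivative (\<lambda>u. deriv2_at \<phi> (F x) (deriv_at F x u) i)) (at x)"
    for i
    by (rule has_derivative_compose[OF has_derivative_deriv_at
          [OF smooth_on_imp_differentiable[OF F x]] smooth_on_deriv2[OF \<phi> F_in[OF x]]])
  \<comment> \<open>expansion over the basis turns the moving vector into real factors of a product\<close>
  have "((\<lambda>y. \<Sum>i\<in>Basis. (deriv_at F y v \<bullet> i) * deriv_at \<phi> (F y) i) has_derivative
      (\<lambda>u. \<Sum>i\<in>Basis. (deriv_at F x v \<bullet> i) * deriv2_at \<phi> (F x) (deriv_at F x u) i
        + (deriv2_at F x u v \<bullet> i) * deriv_at \<phi> (F x) i)) (at x)"
    by (intro has_derivative_sum has_derivative_mult D has_derivative_inner_left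
        smooth_on_deriv2[OF F x])
  then have "((\<lambda>y. deriv_at (\<lambda>y. \<phi> (F y)) y v) has_derivative
      (\<lambda>u. \<Sum>i\<in>Basis. (deriv_at F x v \<bullet> i) * deriv2_at \<phi> (F x) (deriv_at F x u) i
        + (deriv2_at F x u v \<bullet> i) * deriv_at \<phi> (F x) i)) (at x)"
    by (rule has_derivative_transform_within_open[OF _ open_U x])
      (simp add: deriv_at_comp expand[OF lin])
  then show ?thesis
    by (simp add: sum.distrib expand[OF lin[OF x]]
        expand[OF deriv2_at_linear2[OF open_target F_in[OF x] \<phi>]])
qed

lemma deriv2_at_comp:
  "x \<in> U \<Longrightarrow> deriv2_at (\<lambda>y. \<phi> (F y)) x u v =
    deriv2_at \<phi> (F x) (deriv_at F x u) (deriv_at F x v) + deriv_at \<phi> (F x) (deriv2_at F x u v)"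
  unfolding deriv2_at_def[of "\<lambda>y. \<phi> (F y)"] by (simp add: deriv_at_eqI[OF has_derivative_deriv_comp])

end

lemma normal_part_linear:
  assumes "inner_product B" "orthonormal B E" "finite E"
  shows "linear (normal_part B (span E))"
  by (rule linearI) (simp_all add: normal_part_orthonormal[OF assms]
      bilinear_ladd[OF inner_product_bilinear[OF assms(1)]]
      bilinear_lmul[OF inner_product_bilinear[OF assms(1)]]
      scaleR_add_left sum.distrib scaleR_diff_right scaleR_sum_right)

lemma pullback_metric_inner_product:
  fixes F :: "'d::euclidean_space \<Rightarrow> 'e::euclidean_space"
  assumes "inner_product (g (F x))" "linear (deriv_at F x)" "inj (deriv_at F x)"
  shows "inner_product (pullback_metric g F x)"
  unfolding inner_product_def
proof (intro conjI allI impI)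
  let ?A = "deriv_at F x"
  show "bilinear (pullback_metric g F x)"
    unfolding bilinear_def pullback_metric_def
    using linear_compose[OF assms(2) inner_product_linear_left[OF assms(1)]]
      linear_compose[OF assms(2) inner_product_linear_right[OF assms(1)]]
    by (simp add: o_def)
  show "pullback_metric g F x u v = pullback_metric g F x v u" for u v
    by (simp add: pullback_metric_def inner_product_commute[OF assms(1)])
  fix v :: 'd assume "v \<noteq> 0"
  then have "?A v \<noteq> 0"
    using linear_injective_0[OF assms(2)] assms(3) by blast
  then show "pullback_metric g F x v v > 0"
    unfolding pullback_metric_def by (rule inner_product_pos[OF assms(1)])
qed

lemma orthonormal_image:
  assumes "inj (deriv_at F x)" "orthonormal (pullback_metric g F x) E"
  shows "orthonormal (g (F x)) (deriv_at F x ` E)"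
  using assms by (auto simp: orthonormal_def pullback_metric_def inj_eq)

locale coord_immersion = coord_metric S g + smooth_composition U S F \<phi>
  for S :: "'e::euclidean_space set" and g :: "'e \<Rightarrow> 'e bform"
    and U :: "'d::euclidean_space set" and F :: "'d \<Rightarrow> 'e" and \<phi> :: "'e \<Rightarrow> real" +
  assumes inj: "x \<in> U \<Longrightarrow> inj (deriv_at F x)"
begin

lemma linear_deriv_F: "x \<in> U \<Longrightarrow> linear (deriv_at F x)"
  by (rule linear_frechet_derivative[OF smooth_on_imp_differentiable[OF F]])

lemma linear_deriv_\<phi>: "x \<in> U \<Longrightarrow> linear (deriv_at \<phi> (F x))"
  by (rule linear_frechet_derivative[OF smooth_on_imp_differentiable[OF \<phi> F_in]])

lemma pullback_inner: "x \<in> U \<Longrightarrow> inner_product (pullback_metric g F x)"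
  by (intro pullback_metric_inner_product inner F_in linear_deriv_F inj)

context
  fixes x E
  assumes x: "x \<in> U" and E: "finite E" "orthonormal (pullback_metric g F x) E" "card E = DIM('d)"
begin

lemma orthonormal_tangent_frame: "orthonormal (g (F x)) (deriv_at F x ` E)"
  by (rule orthonormal_image[OF inj[OF x] E(2)])

lemma span_tangent_frame: "span (deriv_at F x ` E) = range (deriv_at F x)"
  using orthonormal_span_UNIV[OF pullback_inner[OF x] E(2,1,3)]
    linear_span_image[OF linear_deriv_F[OF x], of E] by simp

lemma mean_curvature_orthonormal: "mean_curvature g F x = (\<Sum>e\<in>E. second_ff g F x e e)"
  unfolding mean_curvature_def
proof (rule metric_trace_orthonormal[OF pullback_inner[OF x] E(2,1,3)])
  let ?A = "deriv_at F x"
  have n: "linear (normal_part (g (F x)) (range ?A))"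
    using normal_part_linear[OF inner[OF F_in[OF x]] orthonormal_tangent_frame] E(1)
    by (simp add: span_tangent_frame)
  note \<Gamma> = christoffel_linear1[OF F_in[OF x]] christoffel_linear2[OF F_in[OF x]]
  show "linear (\<lambda>u. second_ff g F x u v)" for v
    unfolding second_ff_def
    by (intro linear_compose[OF _ n, unfolded o_def] linear_compose_add deriv2_at_linear1[OF F x]
        linear_compose[OF linear_deriv_F[OF x] \<Gamma>(1), unfolded o_def])
  show "linear (second_ff g F x u)" for u
    unfolding second_ff_def[abs_def]
    by (intro linear_compose[OF _ n, unfolded o_def] linear_compose_add
        deriv2_at_linear2[OF open_U x F]
        linear_compose[OF linear_deriv_F[OF x] \<Gamma>(2), unfolded o_def])
qed

text \<open>At a maximum of \<open>\<phi>\<close> along the submanifold the gradient is normal. Hence the differential of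
  \<open>\<phi>\<close> does not see the projection to the normal space, and the trace of
  \<open>D\<^sup>2(\<phi> \<circ> F)(u,u) = Hess \<phi> (dF u, dF u) + d\<phi>(II(u,u))\<close> is the trace of the Hessian plus
  \<open>d\<phi>(H) = \<mu> |\<nabla>\<phi>|\<^sup>2\<close>.\<close>

lemma trace_hessian_nonpos_at_max:
  assumes max: "\<And>y. y \<in> U \<Longrightarrow> \<phi> (F y) \<le> \<phi> (F x)"
    and H: "mean_curvature g F x =
      \<mu> *\<^sub>R normal_part (g (F x)) (range (deriv_at F x)) (gradient g \<phi> (F x))"
    and \<mu>: "\<mu> \<ge> 0"
  shows "(\<Sum>e\<in>E. hessian g \<phi> (F x) (deriv_at F x e) (deriv_at F x e)) \<le> 0"
proof -
  let ?A = "deriv_at F x" and ?d\<phi> = "deriv_at \<phi> (F x)" and ?G = "g (F x)"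
  let ?n = "normal_part ?G (range ?A)" and ?grad = "gradient g \<phi> (F x)"
  let ?h = "\<lambda>y. \<phi> (F y)"
  have diff: "?h differentiable (at y)" if "y \<in> U" for y
    using has_derivative_comp[OF that] by (auto simp: differentiable_def)
  have diff2: "(\<lambda>y. deriv_at ?h y v) differentiable (at x)" for v
    using has_derivative_deriv_comp[OF x] unfolding differentiable_def by blast
  have crit: "?d\<phi> (?A v) = 0" for v
    using deriv_at_local_max[OF open_U x diff[OF x] max] deriv_at_comp[OF x] by simp
  have normal: "?d\<phi> (?n v) = ?d\<phi> v" for v
  proof -
    have "v - ?n v = (\<Sum>e\<in>?A ` E. ?G v e *\<^sub>R e)"
      using normal_part_orthonormal[OF inner[OF F_in[OF x]] orthonormal_tangent_frame] E(1)
      by (simp add: span_tangent_frame)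
    also have "\<dots> \<in> span (?A ` E)"
      by (intro span_sum span_scale span_base)
    finally have "v - ?n v \<in> range ?A"
      by (simp only: span_tangent_frame)
    then have "?d\<phi> (v - ?n v) = 0" using crit by auto
    then show ?thesis by (simp add: linear_diff[OF linear_deriv_\<phi>[OF x]])
  qed
  have "?d\<phi> (mean_curvature g F x) = \<mu> * ?d\<phi> ?grad"
    by (simp add: H linear_cmul[OF linear_deriv_\<phi>[OF x]] normal)
  also have "?d\<phi> ?grad = ?G ?grad ?grad"
    unfolding gradient_def
    by (rule sharp_works[OF inner[OF F_in[OF x]] linear_deriv_\<phi>[OF x], symmetric])
  also have "\<mu> * ?G ?grad ?grad \<ge> 0"
    using \<mu> inner_product_pos[OF inner[OF F_in[OF x]], of ?grad]
      bilinear_lzero[OF inner_product_bilinear[OF inner[OF F_in[OF x]]], of ?grad]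
    by (cases "?grad = 0") auto
  finally have "?d\<phi> (mean_curvature g F x) \<ge> 0" .
  moreover have "?d\<phi> (mean_curvature g F x) = (\<Sum>e\<in>E. ?d\<phi> (second_ff g F x e e))"
    by (simp add: mean_curvature_orthonormal linear_sum[OF linear_deriv_\<phi>[OF x]])
  moreover have "hessian g \<phi> (F x) (?A e) (?A e) + ?d\<phi> (second_ff g F x e e) \<le> 0" for e
    using deriv2_at_local_max[OF open_U x diff diff2 max, of e]
    by (simp add: hessian_def second_ff_def normal deriv2_at_comp[OF x]
        linear_add[OF linear_deriv_\<phi>[OF x]])
  then have "(\<Sum>e\<in>E. hessian g \<phi> (F x) (?A e) (?A e)) + (\<Sum>e\<in>E. ?d\<phi> (second_ff g F x e e)) \<le> 0"
    unfolding sum.distrib[symmetric] by (rule sum_nonpos)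
  ultimately show ?thesis by linarith
qed

end

end

text \<open>Tracing the soliton equation over the Lagrangian tangent space gives \<open>m - R/2\<close> for the trace of
  the Hessian, because the Ricci form is invariant under the complex structure.\<close>

lemma (in coord_kaehler) no_lagrangian_expander_at_max:
  fixes F :: "'d::euclidean_space \<Rightarrow> complex^'m"
  assumes "coord_immersion S g U F \<phi>" and x: "x \<in> U"
    and dim: "DIM('d) = CARD('m)"
    and lagr: "\<And>u v. g (F x) (cplx_J (deriv_at F x u)) (deriv_at F x v) = 0"
    and soliton: "\<And>u v. ricci g (F x) u v + hessian g \<phi> (F x) u v = g (F x) u v"
    and H: "mean_curvature g F x =
      \<mu> *\<^sub>R normal_part (g (F x)) (range (deriv_at F x)) (gradient g \<phi> (F x))"
    and \<mu>: "\<mu> \<ge> 0"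
    and max: "\<And>y. y \<in> U \<Longrightarrow> \<phi> (F y) \<le> \<phi> (F x)"
  shows "scalar_curvature g (F x) \<ge> 2 * real CARD('m)"
proof -
  interpret coord_immersion S g U F \<phi> by fact
  let ?A = "deriv_at F x"
  obtain E where E: "finite E" "orthonormal (pullback_metric g F x) E" "card E = DIM('d)"
    using orthonormal_basis_exists[OF pullback_inner[OF x]] .
  note Fx = F_in[OF x]
  have inj_E: "inj_on ?A E" using inj[OF x] by (rule inj_on_subset) simp
  have "scalar_curvature g (F x) = 2 * (\<Sum>e\<in>?A ` E. ricci g (F x) e e)"
    unfolding scalar_curvature_def
  proof (rule metric_trace_lagrangian[OF inner[OF Fx] hermitian[OF Fx]
        orthonormal_tangent_frame[OF x E]])
    show "finite (?A ` E)" using E(1) by simp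
    show "card (?A ` E) = CARD('m)" by (simp add: card_image[OF inj_E] E(3) dim)
    show "g (F x) (cplx_J a) b = 0" if "a \<in> ?A ` E" "b \<in> ?A ` E" for a b
      using that lagr by auto
  qed (intro ricci_linear1[OF Fx] ricci_linear2[OF Fx] ricci_J_J[OF Fx])+
  also have "(\<Sum>e\<in>?A ` E. ricci g (F x) e e)
      = (\<Sum>e\<in>E. g (F x) (?A e) (?A e) - hessian g \<phi> (F x) (?A e) (?A e))"
    unfolding sum.reindex[OF inj_E] o_def
    by (rule sum.cong[OF refl]) (simp flip: soliton)
  also have "\<dots> = CARD('m) - (\<Sum>e\<in>E. hessian g \<phi> (F x) (?A e) (?A e))"
    using E(2,3) dim by (simp add: sum_subtractf orthonormal_def pullback_metric_def)
  finally show ?thesis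
    using trace_hessian_nonpos_at_max[OF x E max H \<mu>] by simp
qed

section \<open>Charts\<close>

lemma param_chart:
  assumes "is_chart X c" "p \<in> fst c"
  shows "param c (snd c p) = p"
proof -
  have "fst c \<subseteq> topspace X" "homeomorphic_map (subtopology X (fst c)) (top_of_set (coords c)) (snd c)"
    using assms(1) by (auto simp: is_chart_def openin_subset)
  then have "inj_on (snd c) (fst c)"
    using homeomorphic_imp_injective_map by (metis topspace_subtopology_subset)
  then show ?thesis using assms(2) by (simp add: param_def)
qed

lemma snd_chart_in_coords: "p \<in> fst c \<Longrightarrow> snd c p \<in> coords c"
  by (simp add: coords_def)

lemma chart_around:
  assumes "smooth_manifold N" "p \<in> topspace (mtop N)"
  obtains c where "c \<in> atlas N" "is_chart (mtop N) c" "p \<in> fst c"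
proof -
  have "p \<in> (\<Union>c\<in>atlas N. fst c)" "\<forall>c\<in>atlas N. is_chart (mtop N) c"
    using assms unfolding smooth_manifold_def by blast+
  then show ?thesis using that by blast
qed

lemma continuous_map_chart:
  assumes "is_chart X c"
  shows "continuous_map (subtopology X (fst c)) (top_of_set (coords c)) (snd c)"
  using assms by (simp add: is_chart_def homeomorphic_imp_continuous_map)

lemma open_chart_overlap:
  assumes c: "is_chart X c" and d: "is_chart Y d" and F: "continuous_map X Y F"
  shows "open (chart_overlap c F d)"
proof -
  let ?V = "{p \<in> fst c. F p \<in> fst d}"
  have "openin X {p \<in> topspace X. F p \<in> fst d}"
    using F d by (intro openin_continuous_map_preimage) (auto simp: is_chart_def)
  then have "openin X (fst c \<inter> {p \<in> topspace X. F p \<in> fst d})"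
    using c by (intro openin_Int) (auto simp: is_chart_def)
  moreover have "fst c \<inter> {p \<in> topspace X. F p \<in> fst d} = ?V"
    using c openin_subset by (fastforce simp: is_chart_def)
  ultimately have "openin (subtopology X (fst c)) ?V"
    by (simp add: openin_subset_topspace_eq openin_subtopology_Int2 subset_openin_subtopology)
  moreover have "open_map (subtopology X (fst c)) (top_of_set (coords c)) (snd c)"
    using c by (simp add: is_chart_def homeomorphic_imp_open_map)
  ultimately have "openin (top_of_set (coords c)) (chart_overlap c F d)"
    unfolding chart_overlap_def open_map_def by blast
  then show ?thesis
    using c openin_open_trans by (auto simp: is_chart_def)
qed

lemma smooth_fun_continuous:
  assumes N: "smooth_manifold N" and f: "smooth_fun N f"
  shows "continuous_map (mtop N) euclideanreal f"
proof (rule pasting_lemma[where I = "atlas N" and T = fst and f = "\<lambda>c. f"])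
  fix c assume c: "c \<in> atlas N"
  then have chart: "is_chart (mtop N) c" using N by (simp add: smooth_manifold_def)
  then show "openin (mtop N) (fst c)" by (simp add: is_chart_def)
  have "continuous_on (coords c) (f \<circ> param c)"
    using f c by (intro smooth_on_imp_continuous_on) (simp add: smooth_fun_def)
  then have "continuous_map (subtopology (mtop N) (fst c)) euclideanreal ((f \<circ> param c) \<circ> snd c)"
    by (intro continuous_map_compose[OF continuous_map_chart[OF chart]]) simp
  then show "continuous_map (subtopology (mtop N) (fst c)) euclideanreal f"
    by (rule continuous_map_eq) (simp add: param_chart[OF chart])
next
  show "\<exists>c. c \<in> atlas N \<and> p \<in> fst c \<and> f p = f p" if "p \<in> topspace (mtop N)" for p
    using chart_around[OF N that] by metis
qed auto

lemma continuous_map_attains_max: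
  assumes "compact_space X" "topspace X \<noteq> {}" "continuous_map X euclideanreal h"
  obtains p where "p \<in> topspace X" "\<And>q. q \<in> topspace X \<Longrightarrow> h q \<le> h p"
proof -
  have "compact (h ` topspace X)"
    using image_compactin[OF _ assms(3), of "topspace X"] assms(1) by (simp add: compact_space_def)
  then show ?thesis
    using compact_attains_sup[of "h ` topspace X"] assms(2) that by auto
qed

lemma kaehler_manifold_coord_kaehler:
  assumes "kaehler_manifold N g" "c \<in> atlas N"
  shows "coord_kaehler (coords c) (g c)"
proof
  have "is_chart (mtop N) c"
    using assms by (auto simp: kaehler_manifold_def complex_manifold_def smooth_manifold_def)
  then show "open (coords c)" by (simp add: is_chart_def)
  show "inner_product (g c x)" if "x \<in> coords c" for x
    using assms that by (simp add: kaehler_manifold_def riemannian_metric_def)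
  show "smooth_on (coords c) (\<lambda>x. g c x u v)" for u v
    using assms by (simp add: kaehler_manifold_def riemannian_metric_def)
  show "g c x (cplx_J u) (cplx_J v) = g c x u v" if "x \<in> coords c" for x u v
    using assms that by (simp add: kaehler_manifold_def)
  show "metric_deriv (g c) x u (cplx_J v) w + metric_deriv (g c) x v (cplx_J w) u
      + metric_deriv (g c) x w (cplx_J u) v = 0" if "x \<in> coords c" for x u v w
    using assms that by (simp add: kaehler_manifold_def metric_deriv_def kaehler_form_def)
qed

theorem theorem1p3:
  fixes N :: "('a, complex^'m) manifold"
    and g :: "('a, complex^'m) metric"
    and f :: "'a \<Rightarrow> real"
  assumes soliton: "gradient_shrinking_KR_soliton N g f"
    and scalar_less: "\<forall>c\<in>atlas N. \<forall>x\<in>coords c. scalar_curvature (g c) x < 2 * real CARD('m)"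
  shows "\<not> (\<exists>(L :: ('b, 'd::euclidean_space) manifold) (F :: 'b \<Rightarrow> 'a).
            smooth_manifold L \<and> compact_space (mtop L) \<and> topspace (mtop L) \<noteq> {} \<and>
            lagrangian_immersion L N g F \<and> self_expander L N g f F)"
proof (rule notI, elim exE conjE)
  fix L :: "('b, 'd) manifold" and F :: "'b \<Rightarrow> 'a"
  assume L: "smooth_manifold L" "compact_space (mtop L)" "topspace (mtop L) \<noteq> {}"
    and lagr: "lagrangian_immersion L N g F" and expander: "self_expander L N g f F"
  have N: "kaehler_manifold N g" "smooth_manifold N" and f: "smooth_fun N f"
    using soliton
    by (auto simp: gradient_shrinking_KR_soliton_def kaehler_manifold_def complex_manifold_def)
  have imm: "immersion L N F"
    using lagr by (simp add: lagrangian_immersion_def)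
  then have cont: "continuous_map (mtop L) (mtop N) F"
    by (simp add: immersion_def smooth_map_def)
  obtain \<mu> where \<mu>: "\<mu> > 0" "self_similar L N g f F \<mu>"
    using expander by (auto simp: self_expander_def)
  obtain p where p: "p \<in> topspace (mtop L)" "\<And>q. q \<in> topspace (mtop L) \<Longrightarrow> f (F q) \<le> f (F p)"
    using continuous_map_attains_max[OF L(2,3)
        continuous_map_compose[OF cont smooth_fun_continuous[OF N(2) f]]] by auto
  obtain c where c: "c \<in> atlas L" "is_chart (mtop L) c" "p \<in> fst c"
    using chart_around[OF L(1) p(1)] .
  have "F p \<in> topspace (mtop N)"
    using continuous_map_image_subset_topspace[OF cont] p(1) by auto
  then obtain d where d: "d \<in> atlas N" "is_chart (mtop N) d" "F p \<in> fst d"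
    using chart_around[OF N(2)] by blast
  let ?F = "in_charts c F d" and ?U = "chart_overlap c F d" and ?\<phi> = "f \<circ> param d"
  define x where "x = snd c p"
  have x: "x \<in> ?U" using c(3) d(3) by (auto simp: x_def chart_overlap_def)
  have F_chart: "?F (snd c q) = snd d (F q)" if "q \<in> fst c" for q
    using param_chart[OF c(2) that] by (simp add: in_charts_def)
  have \<phi>_chart: "?\<phi> (?F (snd c q)) = f (F q)" if "q \<in> fst c" "F q \<in> fst d" for q
    using param_chart[OF d(2) that(2)] by (simp add: F_chart[OF that(1)])
  have in_coords: "?F y \<in> coords d" if "y \<in> ?U" for y
    using that by (auto simp: chart_overlap_def F_chart snd_chart_in_coords)
  interpret coord_kaehler "coords d" "g d"
    by (rule kaehler_manifold_coord_kaehler[OF N(1) d(1)])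
  have "coord_immersion (coords d) (g d) ?U ?F ?\<phi>"
  proof
    show "open ?U" by (rule open_chart_overlap[OF c(2) d(2) cont])
    show "smooth_on ?U ?F"
      using imm c(1) d(1) by (simp add: immersion_def smooth_map_def)
    show "smooth_on (coords d) ?\<phi>" using f d(1) by (simp add: smooth_fun_def)
    show "inj (deriv_at ?F y)" if "y \<in> ?U" for y
      using imm c(1) d(1) that by (simp add: immersion_def)
  qed (use in_coords open_S in auto)
  then have "scalar_curvature (g d) (?F x) \<ge> 2 * real CARD('m)"
  proof (rule no_lagrangian_expander_at_max[OF _ x])
    show "DIM('d) = CARD('m)"
      using lagr by (simp add: lagrangian_immersion_def)
    show "g d (?F x) (cplx_J (deriv_at ?F x u)) (deriv_at ?F x v) = 0" for u v
      using lagr c(1) d(1) x by (simp add: lagrangian_immersion_def kaehler_form_def Let_def)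
    show "ricci (g d) (?F x) u v + hessian (g d) ?\<phi> (?F x) u v = g d (?F x) u v" for u v
      using soliton d(1) in_coords[OF x] by (simp add: gradient_shrinking_KR_soliton_def)
    show "mean_curvature (g d) ?F x = \<mu> *\<^sub>R normal_part (g d (?F x)) (range (deriv_at ?F x))
        (gradient (g d) ?\<phi> (?F x))"
      using \<mu>(2) c(1) d(1) x by (simp add: self_similar_def Let_def)
    show "?\<phi> (?F y) \<le> ?\<phi> (?F x)" if "y \<in> ?U" for y
    proof -
      obtain q where q: "q \<in> fst c" "F q \<in> fst d" "y = snd c q"
        using \<open>y \<in> ?U\<close> by (auto simp: chart_overlap_def)
      moreover have "q \<in> topspace (mtop L)"
        using q(1) c(2) openin_subset by (fastforce simp: is_chart_def)
      ultimately show ?thesis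
        using p(2) \<phi>_chart c(3) d(3) unfolding x_def q(3) by metis
    qed
  qed (use \<mu>(1) in simp)
  then show False
    using scalar_less d(1) in_coords[OF x] by force
qed

end
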